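(* Let $d\ge 3$. Every rational simplicial $d$-cone $C\subset\mathbb{R}^d$ admits a unimodular triangulation $C=D_1\cup\dots\cup D_T$ such that $$\mathrm{Hilb}(D_t)\subset\Bigl(\frac d2\Bigl(\frac32\Bigr)^{\mu(\Delta_C)-2}\Bigr)\Delta_C,\qquad t\in[1,T].$$
   Context: Cones are polyhedral, rational, pointed; $\mathrm{Hilb}(C)$ is the minimal generating set of the semigroup $C\cap\mathbb{Z}^d$; extreme integral generators of $C$ are the primitive lattice vectors on the edges of $C$; $\Delta_C$ is the convex hull of $O$ and the extreme integral generators. For a lattice simplex with vertices $v_0,\dots,v_e$, $\mu$ denotes its multiplicity: the index of the subgroup $U$ generated by $v_i-v_0$ in the smallest direct summand of $\mathbb{Z}^d$ containing $U$ (for full-dimensional simplices, $d!$ times the volume). A unimodular cone is a simplicial cone $D$ with $\mu(\Delta_D)=1$. A unimodular triangulation of $C$ is a finite family of unimodular cones with union $C$ any two of which intersect in a common face. $c\Delta_C$ is the dilate with center $O$. *)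

theory Defs
  imports "HOL-Analysis.Analysis"
begin

definition int_vec :: "real^'n \<Rightarrow> bool" where
  "int_vec x \<longleftrightarrow> (\<forall>i. x $ i \<in> \<int>)"

definition rat_vec :: "real^'n \<Rightarrow> bool" where
  "rat_vec x \<longleftrightarrow> (\<forall>i. x $ i \<in> \<rat>)"

definition pos_hull :: "(real^'n) set \<Rightarrow> (real^'n) set" where
  "pos_hull V = {y. \<exists>c. (\<forall>v\<in>V. 0 \<le> c v) \<and> y = (\<Sum>v\<in>V. c v *\<^sub>R v)}"

definition simplicial_cone :: "(real^'n) set \<Rightarrow> bool" where
  "simplicial_cone D \<longleftrightarrow>
     (\<exists>V. finite V \<and> independent V \<and> (\<forall>v\<in>V. rat_vec v) \<and> D = pos_hull V)"

definition extreme_gens :: "(real^'n) set \<Rightarrow> (real^'n) set" where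
  "extreme_gens C = {u. int_vec u \<and> u \<noteq> 0 \<and>
       (\<exists>E. E face_of C \<and> aff_dim E = 1 \<and> u \<in> E) \<and>
       (\<forall>t. 0 < t \<and> t < 1 \<longrightarrow> \<not> int_vec (t *\<^sub>R u))}"

definition Delta :: "(real^'n) set \<Rightarrow> (real^'n) set" where
  "Delta C = convex hull (insert 0 (extreme_gens C))"

text \<open>Subgroup of Z^d generated by W, and the smallest direct summand containing it
  (its saturation: span W intersected with Z^d).\<close>
definition lattice_gen :: "(real^'n) set \<Rightarrow> (real^'n) set" where
  "lattice_gen W = {y. \<exists>k. (\<forall>w\<in>W. k w \<in> \<int>) \<and> y = (\<Sum>w\<in>W. k w *\<^sub>R w)}"

definition saturation :: "(real^'n) set \<Rightarrow> (real^'n) set" where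
  "saturation W = span W \<inter> {x. int_vec x}"

definition lattice_index :: "(real^'n) set \<Rightarrow> nat" where
  "lattice_index W = card ((\<lambda>x. (\<lambda>u. x + u) ` lattice_gen W) ` saturation W)"

definition simplex_mult :: "(real^'n) set \<Rightarrow> nat" where
  "simplex_mult V = (let v0 = (SOME v. v \<in> V) in lattice_index ((\<lambda>v. v - v0) ` (V - {v0})))"

definition mu :: "(real^'n) set \<Rightarrow> nat" where
  "mu P = simplex_mult {x. x extreme_point_of P}"

definition monoid_gen :: "(real^'n) set \<Rightarrow> (real^'n) set" where
  "monoid_gen H = {y. \<exists>F k. finite F \<and> F \<subseteq> H \<and> y = (\<Sum>h\<in>F. real (k h :: nat) *\<^sub>R h)}"

definition hilb :: "(real^'n) set \<Rightarrow> (real^'n) set" where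
  "hilb C = (THE H. H \<subseteq> C \<inter> {x. int_vec x} \<and> monoid_gen H = C \<inter> {x. int_vec x} \<and>
       (\<forall>H'. H' \<subset> H \<longrightarrow> monoid_gen H' \<noteq> C \<inter> {x. int_vec x}))"

definition unimodular_cone :: "(real^'n) set \<Rightarrow> bool" where
  "unimodular_cone D \<longleftrightarrow> simplicial_cone D \<and> mu (Delta D) = 1"

definition unimodular_triangulation :: "(real^'n) set \<Rightarrow> (real^'n) set set \<Rightarrow> bool" where
  "unimodular_triangulation C T \<longleftrightarrow> finite T \<and> (\<forall>D\<in>T. unimodular_cone D) \<and> \<Union>T = C \<and>
     (\<forall>D1\<in>T. \<forall>D2\<in>T. (D1 \<inter> D2) face_of D1 \<and> (D1 \<inter> D2) face_of D2)"

end

theory Submission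
  imports Defs
begin

text \<open>Starting from the cone itself, repeatedly perform stellar subdivision at a nonzero lattice
  point \<open>x\<close> of the half-open parallelepiped of some non-unimodular cone. Replacing a generator by
  \<open>x\<close> strictly decreases the lattice index of every affected cone, so the process stops with
  unimodular cones. Let \<open>F\<close> be the generators occurring in \<open>x\<close> and let \<open>N\<close> be the linear height
  that is \<open>1\<close> on the extreme generators of \<open>C\<close>. Passing to \<open>\<Sum>F - x\<close> if necessary, \<open>N x\<close> is at most
  half the sum of the heights of the generators of every cone containing \<open>F\<close>. Hence, for a cone of
  index \<open>i\<close> arising from one of index \<open>m\<close>, the sum of the heights stays at most \<open>d (3/2)^(m - i)\<close> and
  each height at most \<open>(d/2) (3/2)^(m - i - 1)\<close>; the claim is the case \<open>i = 1\<close>. The initial bound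
  \<open>1 \<le> d/3\<close> is where \<open>d \<ge> 3\<close> enters.\<close>

section \<open>Simplicial cones\<close>

lemma comb_unique:
  fixes W :: "(real^'n) set"
  assumes "finite W" "independent W" "(\<Sum>w\<in>W. a w *\<^sub>R w) = (\<Sum>w\<in>W. b w *\<^sub>R w)" "w \<in> W"
  shows "a w = b w"
proof -
  have "(\<Sum>w\<in>W. (a w - b w) *\<^sub>R w) = 0"
    using assms(3) by (simp add: scaleR_diff_left sum_subtractf)
  then have "a w - b w = 0"
    using independentD[OF assms(2,1) subset_refl, of "\<lambda>w. a w - b w"] assms(4) by simp
  then show ?thesis by simp
qed

lemma comb_extend:
  fixes W :: "(real^'n) set"
  assumes "finite W" "S \<subseteq> W"
  shows "(\<Sum>w\<in>S. c w *\<^sub>R w) = (\<Sum>w\<in>W. (if w \<in> S then c w else 0) *\<^sub>R w)"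
  using assms by (intro sum.mono_neutral_cong_left) auto

lemma comb_delta:
  fixes W :: "(real^'n) set"
  assumes "finite W" "v \<in> W"
  shows "(\<Sum>w\<in>W. (if w = v then t else 0) *\<^sub>R w) = t *\<^sub>R v"
proof -
  have "(\<Sum>w\<in>W. (if w = v then t else 0) *\<^sub>R w) = (\<Sum>w\<in>W. if w = v then t *\<^sub>R w else 0)"
    by (intro sum.cong) auto
  then show ?thesis using assms by simp
qed

lemma comb_single:
  fixes W :: "(real^'n) set"
  assumes "finite W" "v \<in> W"
  shows "v = (\<Sum>w\<in>W. (if w = v then 1 else 0) *\<^sub>R w)"
  using comb_delta[OF assms, of 1] by simp

lemma span_eq_UNIV:
  fixes W :: "(real^'n) set"
  assumes "independent W" "card W = CARD('n)"
  shows "span W = UNIV"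
  using card_ge_dim_independent[of W UNIV] assms by (auto simp: dim_UNIV)

lemma obtain_comb:
  fixes W :: "(real^'n) set"
  assumes "finite W" "span W = UNIV"
  obtains c where "y = (\<Sum>w\<in>W. c w *\<^sub>R w)"
proof -
  have "y \<in> range (\<lambda>u. \<Sum>v\<in>W. u v *\<^sub>R v)"
    using assms span_finite[of W] by blast
  then show ?thesis using that by blast
qed

section \<open>Positive hulls and their faces\<close>

lemma pos_hullI: "\<lbrakk>\<And>v. v \<in> V \<Longrightarrow> 0 \<le> c v; y = (\<Sum>v\<in>V. c v *\<^sub>R v)\<rbrakk> \<Longrightarrow> y \<in> pos_hull V"
  unfolding pos_hull_def by blast

lemma pos_hullE:
  assumes "y \<in> pos_hull V"
  obtains c where "\<And>v. v \<in> V \<Longrightarrow> 0 \<le> c v" "y = (\<Sum>v\<in>V. c v *\<^sub>R v)"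
  using assms unfolding pos_hull_def by blast

lemma pos_hull_mono:
  assumes "finite W" "S \<subseteq> W"
  shows "pos_hull S \<subseteq> pos_hull W"
proof
  fix y assume "y \<in> pos_hull S"
  then obtain c where "\<And>v. v \<in> S \<Longrightarrow> 0 \<le> c v" "y = (\<Sum>v\<in>S. c v *\<^sub>R v)"
    by (elim pos_hullE) blast
  then show "y \<in> pos_hull W"
    by (intro pos_hullI[where c="\<lambda>w. if w \<in> S then c w else 0"]) (auto simp: comb_extend[OF assms])
qed

lemma pos_hull_add: "\<lbrakk>x \<in> pos_hull W; y \<in> pos_hull W\<rbrakk> \<Longrightarrow> x + y \<in> pos_hull W"
proof (elim pos_hullE)
  fix a b assume "\<And>v. v \<in> W \<Longrightarrow> 0 \<le> a v" "x = (\<Sum>v\<in>W. a v *\<^sub>R v)"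
    "\<And>v. v \<in> W \<Longrightarrow> 0 \<le> b v" "y = (\<Sum>v\<in>W. b v *\<^sub>R v)"
  then show ?thesis
    by (intro pos_hullI[where c="\<lambda>w. a w + b w"]) (auto simp: scaleR_add_left sum.distrib)
qed

lemma pos_hull_scale: "\<lbrakk>x \<in> pos_hull W; 0 \<le> t\<rbrakk> \<Longrightarrow> t *\<^sub>R x \<in> pos_hull W"
proof (elim pos_hullE)
  fix a assume "\<And>v. v \<in> W \<Longrightarrow> 0 \<le> a v" "x = (\<Sum>v\<in>W. a v *\<^sub>R v)" "0 \<le> t"
  then show ?thesis
    by (intro pos_hullI[where c="\<lambda>w. t * a w"]) (auto simp: scaleR_sum_right)
qed

lemma pos_hull_0: "0 \<in> pos_hull W"
  by (rule pos_hullI[where c="\<lambda>_. 0"]) auto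

lemma pos_hull_base:
  assumes "finite W" "v \<in> W" shows "v \<in> pos_hull W"
  by (rule pos_hullI[OF _ comb_single[OF assms]]) auto

lemma convex_pos_hull: "convex (pos_hull W)"
  by (auto simp: convex_def intro!: pos_hull_add pos_hull_scale)

text \<open>Coordinates over an independent set are unique, so membership in a subcone becomes the
  vanishing of the remaining coordinates. This is the tool for the face property below.\<close>

lemma pos_hull_subset_eq:
  assumes "finite W" "independent W" "S \<subseteq> W"
    and "\<And>w. w \<in> W \<Longrightarrow> 0 \<le> c w"
  shows "(\<Sum>w\<in>W. c w *\<^sub>R w) \<in> pos_hull S \<longleftrightarrow> (\<forall>w\<in>W-S. c w = 0)"
proof
  assume "(\<Sum>w\<in>W. c w *\<^sub>R w) \<in> pos_hull S"
  then obtain a where "(\<Sum>w\<in>W. c w *\<^sub>R w) = (\<Sum>w\<in>S. a w *\<^sub>R w)"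
    by (elim pos_hullE) blast
  then have "(\<Sum>w\<in>W. c w *\<^sub>R w) = (\<Sum>w\<in>W. (if w \<in> S then a w else 0) *\<^sub>R w)"
    by (simp add: comb_extend[OF assms(1,3)])
  from comb_unique[OF assms(1,2) this] show "\<forall>w\<in>W-S. c w = 0" by auto
next
  assume "\<forall>w\<in>W-S. c w = 0"
  then have "(\<Sum>w\<in>W. c w *\<^sub>R w) = (\<Sum>w\<in>S. c w *\<^sub>R w)"
    using assms(1,3) by (intro sum.mono_neutral_right) auto
  then show "(\<Sum>w\<in>W. c w *\<^sub>R w) \<in> pos_hull S"
    using assms(3,4) by (intro pos_hullI[of S c]) auto
qed

lemma pos_hull_face:
  assumes "finite W" "independent W" "S \<subseteq> W"
  shows "pos_hull S face_of pos_hull W"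
  unfolding face_of_def
proof (intro conjI ballI impI pos_hull_mono[OF assms(1,3)] convex_pos_hull)
  fix a b x assume "a \<in> pos_hull W" "b \<in> pos_hull W" "x \<in> pos_hull S" and x: "x \<in> open_segment a b"
  then obtain p q where p: "\<And>v. v \<in> W \<Longrightarrow> 0 \<le> p v" "a = (\<Sum>v\<in>W. p v *\<^sub>R v)"
    and q: "\<And>v. v \<in> W \<Longrightarrow> 0 \<le> q v" "b = (\<Sum>v\<in>W. q v *\<^sub>R v)"
    by (elim pos_hullE) blast
  obtain u where u: "0 < u" "u < 1" "x = (1 - u) *\<^sub>R a + u *\<^sub>R b"
    using x by (auto simp: in_segment)
  have xe: "x = (\<Sum>v\<in>W. ((1-u) * p v + u * q v) *\<^sub>R v)"
    unfolding u(3) p(2) q(2) by (simp add: scaleR_sum_right scaleR_add_left sum.distrib)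
  have "\<forall>w\<in>W-S. (1-u) * p w + u * q w = 0"
    using pos_hull_subset_eq[OF assms, of "\<lambda>v. (1-u) * p v + u * q v"] \<open>x \<in> pos_hull S\<close> p(1) q(1) u
    unfolding xe by simp
  \<comment> \<open>A sum of two nonnegative terms with positive weights vanishes only if both terms
    do.\<close>
  then have "\<forall>w\<in>W-S. p w = 0 \<and> q w = 0"
    using p(1) q(1) u by (smt (verit) DiffD1 mult_nonneg_nonneg mult_pos_pos)
  then show "a \<in> pos_hull S" "b \<in> pos_hull S"
    unfolding p(2) q(2)
    using pos_hull_subset_eq[OF assms, of p] pos_hull_subset_eq[OF assms, of q] p(1) q(1) by auto
qed

section \<open>Primitive vectors and extreme generators\<close>

text \<open>The zero vector is not primitive, since each of its multiples is integral.\<close>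

definition primitive :: "real^'n \<Rightarrow> bool" where
  "primitive u \<longleftrightarrow> int_vec u \<and> (\<forall>t. 0 < t \<and> t < 1 \<longrightarrow> \<not> int_vec (t *\<^sub>R u))"

lemma aff_dim_pos_hull_single:
  fixes w :: "real^'n"
  assumes "w \<noteq> 0"
  shows "aff_dim (pos_hull {w}) = 1"
proof -
  have "{0, w} \<subseteq> pos_hull {w}" using pos_hull_0 pos_hull_base[of "{w}" w] by auto
  moreover have "pos_hull {w} \<subseteq> span {w}"
    by (auto simp: pos_hull_def intro: span_mul span_base)
  ultimately have "aff_dim {0,w} \<le> aff_dim (pos_hull {w})" "aff_dim (pos_hull {w}) \<le> aff_dim (span {w})"
    by (meson aff_dim_subset)+
  moreover have "aff_dim (span {w}) = 1"
    using assms by (simp add: aff_dim_subspace dim_span)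
  ultimately show ?thesis using assms by simp
qed

text \<open>Write \<open>u\<close> as the midpoint of \<open>(2 * c v) *\<^sub>R v\<close> and twice
  the rest of its expansion. The face property puts every generator with positive coefficient into
  the span of \<open>E\<close>. That span has dimension 1, so only one such generator
  exists.\<close>

lemma ray_face_gen:
  fixes W :: "(real^'n) set"
  assumes W: "finite W" "independent W"
    and E: "E face_of pos_hull W" "aff_dim E = 1" "u \<in> E" "u \<noteq> 0"
  shows "\<exists>w\<in>W. \<exists>t>0. u = t *\<^sub>R w"
proof -
  have "u \<in> pos_hull W" using E face_of_imp_subset by blast
  then obtain c where c: "\<And>v. v \<in> W \<Longrightarrow> 0 \<le> c v" "u = (\<Sum>v\<in>W. c v *\<^sub>R v)"
    by (elim pos_hullE) blast
  have half: "p \<in> E \<and> q \<in> E" if "p \<in> pos_hull W" "q \<in> pos_hull W" "p + q = 2 *\<^sub>R u" "p \<noteq> q" for p q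
  proof -
    have "u = (1/2) *\<^sub>R (p + q)" using that(3) by simp
    then have "u = (1 - 1/2) *\<^sub>R p + (1/2) *\<^sub>R q" by (simp add: scaleR_add_right)
    then have "u \<in> open_segment p q" using that(4) unfolding in_segment by (intro conjI exI[of _ "1/2"]) auto
    then show ?thesis using face_ofD[OF E(1)] that E(3) by blast
  qed
  \<comment> \<open>\<open>u\<close> is the midpoint of 0 and \<open>2 *\<^sub>R u\<close>. With 0
    in \<open>E\<close>, affine and linear dimension agree.\<close>
  have "0 \<in> E"
    using half[of 0 "2 *\<^sub>R u"] E(4) \<open>u \<in> pos_hull W\<close> by (auto simp: pos_hull_0 pos_hull_scale)
  then have d1: "dim E = 1" using E(2) aff_dim_zero[of E] by (simp add: hull_inc)
  have inE: "v \<in> span E" if v: "v \<in> W" "c v > 0" for v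
  proof -
    let ?p = "(2 * c v) *\<^sub>R v" and ?q = "\<Sum>w\<in>W-{v}. (2 * c w) *\<^sub>R w"
    have "?p \<in> pos_hull W" using v W by (intro pos_hull_scale pos_hull_base) auto
    moreover have "?q \<in> pos_hull (W - {v})" using c by (intro pos_hullI) auto
    then have "?q \<in> pos_hull W" using pos_hull_mono[OF W(1), of "W - {v}"] by blast
    moreover have "?p + ?q = 2 *\<^sub>R u"
      unfolding c(2) using W(1) v(1)
      by (simp add: scaleR_sum_right sum.remove[OF W(1) v(1), of "\<lambda>w. (2 * c w) *\<^sub>R w"])
    \<comment> \<open>The open segment is empty when the endpoints coincide; here the coordinates at
      \<open>v\<close> are \<open>2 * c v\<close> and 0.\<close>
    moreover have "?p \<noteq> ?q"
    proof
      assume "?p = ?q"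
      moreover have "?p = (\<Sum>w\<in>W. (if w = v then 2 * c v else 0) *\<^sub>R w)"
        using W(1) v(1) by (subst sum.remove[OF W(1) v(1)]) auto
      moreover have "?q = (\<Sum>w\<in>W. (if w = v then 0 else 2 * c w) *\<^sub>R w)"
        using W(1) v(1) by (subst sum.remove[OF W(1) v(1)]) (auto intro!: sum.cong)
      ultimately have "(if v = v then 2 * c v else 0) = (if v = v then 0 else 2 * c v)"
        by (intro comb_unique[OF W, where a="\<lambda>w. if w = v then 2 * c v else 0" and b="\<lambda>w. if w = v then 0 else 2 * c w"]) (use v in auto)
      then show False using v(2) by simp
    qed
    ultimately have "?p \<in> E" using half by blast
    then have "(1 / (2 * c v)) *\<^sub>R ?p \<in> span E" by (intro span_mul span_base)
    then show ?thesis using v(2) by simp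
  qed
  have uniq: "v = w" if "v \<in> W" "w \<in> W" "c v > 0" "c w > 0" for v w
  proof (rule ccontr)
    assume "v \<noteq> w"
    have "card {v,w} \<le> dim (span E)"
    proof (rule independent_card_le_dim)
      show "{v,w} \<subseteq> span E" using inE that by auto
      show "independent {v,w}" by (rule independent_mono[OF W(2)]) (use that in auto)
    qed
    then show False using d1 \<open>v \<noteq> w\<close> by (simp add: dim_span)
  qed
  obtain w where w: "w \<in> W" "c w > 0"
  proof -
    have "\<exists>w\<in>W. c w > 0"
    proof (rule ccontr)
      assume "\<not> (\<exists>w\<in>W. c w > 0)"
      then have "\<forall>w\<in>W. c w = 0" using c(1) by force
      then show False using c(2) E(4) by simp
    qed
    then show ?thesis using that by blast
  qed
  have "c v = 0" if "v \<in> W - {w}" for v using uniq[of v w] c(1)[of v] w that by force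
  then have "u = c w *\<^sub>R w" unfolding c(2) by (subst sum.remove[OF W(1) w(1)]) simp
  then show ?thesis using w by blast
qed

lemma primitive_multiple:
  assumes "primitive u" "primitive w" "u = t *\<^sub>R w" "t > 0"
  shows "u = w"
proof -
  have "w = (1/t) *\<^sub>R u" using assms(3,4) by simp
  then have "\<not> t > 1" using assms unfolding primitive_def by (metis divide_less_eq_1 less_trans zero_less_divide_1_iff zero_less_one)
  moreover have "\<not> t < 1" using assms unfolding primitive_def by metis
  ultimately show ?thesis using assms by simp
qed

lemma extreme_gens_pos_hull:
  fixes W :: "(real^'n) set"
  assumes W: "finite W" "independent W" and prim: "\<And>w. w \<in> W \<Longrightarrow> primitive w"
  shows "extreme_gens (pos_hull W) = W"
proof (intro equalityI subsetI)
  fix u assume "u \<in> extreme_gens (pos_hull W)"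
  then have "primitive u" "u \<noteq> 0" and "\<exists>E. E face_of pos_hull W \<and> aff_dim E = 1 \<and> u \<in> E"
    unfolding extreme_gens_def primitive_def by auto
  then obtain w t where w: "w \<in> W" "t > 0" "u = t *\<^sub>R w" using ray_face_gen[OF W] by metis
  then show "u \<in> W" using primitive_multiple[OF \<open>primitive u\<close> prim[OF w(1)] w(3,2)] by simp
next
  fix w assume w: "w \<in> W"
  then have "w \<noteq> 0" using W(2) dependent_zero by auto
  then show "w \<in> extreme_gens (pos_hull W)"
    using prim[OF w] pos_hull_face[OF W, of "{w}"] w aff_dim_pos_hull_single[of w] pos_hull_base[of "{w}" w]
    unfolding extreme_gens_def primitive_def by blast
qed

text \<open>The missing weight is given to the vertex 0. Since \<open>W\<close> may itself contain
  0, that weight is computed from \<open>W - {0}\<close>.\<close>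

lemma convex_comb_0:
  fixes W :: "(real^'n) set"
  assumes "finite W" "\<And>w. w \<in> W \<Longrightarrow> 0 \<le> c w" "sum c W \<le> 1"
  shows "(\<Sum>w\<in>W. c w *\<^sub>R w) \<in> convex hull (insert 0 W)"
  using assms
proof -
  let ?H = "convex hull (insert 0 W)"
  have "(\<Sum>w\<in>insert 0 W. (if w = 0 then 1 - sum c (W-{0}) else c w) *\<^sub>R w) \<in> ?H"
  proof (rule convex_sum)
    have *: "sum c (W-{0}) \<le> 1"
      using sum_mono2[of W "W-{0}" c] assms by force
    have "(\<Sum>w\<in>insert 0 W. if w = 0 then 1 - sum c (W-{0}) else c w)
        = (1 - sum c (W-{0})) + (\<Sum>w\<in>insert 0 W - {0}. if w = 0 then 1 - sum c (W-{0}) else c w)"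
      using assms(1) by (subst sum.remove[of _ 0]) auto
    also have "(\<Sum>w\<in>insert 0 W - {0}. if w = 0 then 1 - sum c (W-{0}) else c w) = sum c (W - {0})"
      by (intro sum.cong) auto
    finally show "(\<Sum>w\<in>insert 0 W. if w = 0 then 1 - sum c (W-{0}) else c w) = 1" by simp
    show "\<And>i. i \<in> insert 0 W \<Longrightarrow> 0 \<le> (if i = 0 then 1 - sum c (W-{0}) else c i)"
      using * assms by auto
  qed (use assms in \<open>auto intro: hull_inc\<close>)
  also have "(\<Sum>w\<in>insert 0 W. (if w = 0 then 1 - sum c (W-{0}) else c w) *\<^sub>R w) = (\<Sum>w\<in>W. c w *\<^sub>R w)"
    using assms(1) by (intro sum.mono_neutral_cong_right) auto
  finally show ?thesis .
qed

section \<open>Lattice indices\<close>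

lemma lattice_genI: "\<lbrakk>\<And>w. w \<in> W \<Longrightarrow> k w \<in> \<int>; y = (\<Sum>w\<in>W. k w *\<^sub>R w)\<rbrakk> \<Longrightarrow> y \<in> lattice_gen W"
  unfolding lattice_gen_def by blast

lemma lattice_genE:
  assumes "y \<in> lattice_gen W"
  obtains k where "\<And>w. w \<in> W \<Longrightarrow> k w \<in> \<int>" "y = (\<Sum>w\<in>W. k w *\<^sub>R w)"
  using assms unfolding lattice_gen_def by blast

lemma lattice_gen_add: "\<lbrakk>x \<in> lattice_gen W; y \<in> lattice_gen W\<rbrakk> \<Longrightarrow> x + y \<in> lattice_gen W"
proof (elim lattice_genE)
  fix a b assume "\<And>w. w \<in> W \<Longrightarrow> a w \<in> \<int>" "x = (\<Sum>w\<in>W. a w *\<^sub>R w)"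
    "\<And>w. w \<in> W \<Longrightarrow> b w \<in> \<int>" "y = (\<Sum>w\<in>W. b w *\<^sub>R w)"
  then show ?thesis
    by (intro lattice_genI[where k="\<lambda>w. a w + b w"]) (auto simp: scaleR_add_left sum.distrib)
qed

lemma lattice_gen_scale: "\<lbrakk>x \<in> lattice_gen W; m \<in> \<int>\<rbrakk> \<Longrightarrow> m *\<^sub>R x \<in> lattice_gen W"
proof (elim lattice_genE)
  fix a assume "\<And>w. w \<in> W \<Longrightarrow> a w \<in> \<int>" "x = (\<Sum>w\<in>W. a w *\<^sub>R w)" "m \<in> \<int>"
  then show ?thesis
    by (intro lattice_genI[where k="\<lambda>w. m * a w"]) (auto simp: scaleR_sum_right)
qed

lemma lattice_gen_0: "0 \<in> lattice_gen W"
  by (rule lattice_genI[where k="\<lambda>_. 0"]) auto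

lemma lattice_gen_uminus: "x \<in> lattice_gen W \<Longrightarrow> - x \<in> lattice_gen W"
  using lattice_gen_scale[of x W "-1"] by simp

lemma lattice_gen_diff: "\<lbrakk>x \<in> lattice_gen W; y \<in> lattice_gen W\<rbrakk> \<Longrightarrow> x - y \<in> lattice_gen W"
  using lattice_gen_add[of x W "- y"] lattice_gen_uminus[of y W] by simp

lemma lattice_gen_base: "\<lbrakk>finite W; w \<in> W\<rbrakk> \<Longrightarrow> w \<in> lattice_gen W"
  using comb_single[of W w] by (intro lattice_genI[where k="\<lambda>v. if v = w then 1 else 0"]) auto

lemma lattice_gen_sum: "(\<And>i. i \<in> I \<Longrightarrow> f i \<in> lattice_gen W) \<Longrightarrow> (\<Sum>i\<in>I. f i) \<in> lattice_gen W"
  by (induction I rule: infinite_finite_induct) (auto intro: lattice_gen_0 lattice_gen_add)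

lemma lattice_gen_subset:
  assumes "\<And>w. w \<in> W \<Longrightarrow> w \<in> lattice_gen W'"
  shows "lattice_gen W \<subseteq> lattice_gen W'"
  using assms by (auto elim!: lattice_genE intro!: lattice_gen_sum lattice_gen_scale)

lemma lattice_gen_subset_span: "lattice_gen W \<subseteq> span W"
  by (auto elim!: lattice_genE intro!: span_sum span_mul intro: span_base)

text \<open>The definition of \<^const>\<open>simplex_mult\<close> picks its base vertex by \<open>SOME\<close>, so it need not be \<open>0\<close>.\<close>
lemma simplex_mult_insert_0:
  fixes W :: "(real^'n) set"
  assumes W: "finite W" "0 \<notin> W"
  shows "simplex_mult (insert 0 W) = lattice_index W"
proof -
  define v where "v = (SOME v. v \<in> insert 0 W)"
  define U where "U = (\<lambda>w. w - v) ` (insert 0 W - {v})"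
  have v: "v \<in> insert 0 W" unfolding v_def by (rule someI[of _ 0]) simp
  have fU: "finite U" using W unfolding U_def by simp
  have inU: "w - v \<in> lattice_gen U" if "w \<in> insert 0 W" for w
  proof (cases "w = v")
    case False
    then have "w - v \<in> U" using that unfolding U_def by blast
    then show ?thesis using lattice_gen_base[OF fU] by blast
  qed (simp add: lattice_gen_0)
  have inW: "w \<in> lattice_gen W" if "w \<in> insert 0 W" for w
    using that lattice_gen_base[OF W(1)] lattice_gen_0 by auto
  have L: "lattice_gen U = lattice_gen W"
  proof
    show "lattice_gen U \<subseteq> lattice_gen W"
      by (rule lattice_gen_subset) (auto simp: U_def simp del: insert_iff intro!: lattice_gen_diff[OF inW inW[OF v]])
    \<comment> \<open>Here \<open>w\<close> is written as \<open>(w - v) - (0 - v)\<close>, which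
      moves the base vertex back to 0.\<close>
    have "w \<in> lattice_gen U" if "w \<in> W" for w
      using lattice_gen_diff[OF inU[of w] inU[of 0]] that by simp
    then show "lattice_gen W \<subseteq> lattice_gen U" by (rule lattice_gen_subset)
  qed
  have S: "span U = span W"
  proof (intro equalityI span_minimal subspace_span)
    have "U \<subseteq> lattice_gen U" using lattice_gen_base[OF fU] by blast
    then show "U \<subseteq> span W" using L lattice_gen_subset_span by blast
    have "W \<subseteq> lattice_gen W" using lattice_gen_base[OF W(1)] by blast
    then show "W \<subseteq> span U" using L lattice_gen_subset_span by blast
  qed
  show ?thesis
    unfolding simplex_mult_def Let_def v_def[symmetric] U_def[symmetric] lattice_index_def saturation_def L S ..
qed

text \<open>Independence of \<open>W\<close> makes 0 together with \<open>W\<close> affinely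
  independent, so these points are exactly the vertices of the simplex, and the multiplicity can be
  computed from the base vertex 0.\<close>

lemma mu_Delta_pos_hull:
  fixes W :: "(real^'n) set"
  assumes W: "finite W" "independent W" and prim: "\<And>w. w \<in> W \<Longrightarrow> primitive w"
  shows "mu (Delta (pos_hull W)) = lattice_index W"
proof -
  have z: "0 \<notin> W" using W(2) dependent_zero by auto
  have "\<not> affine_dependent (insert 0 W)"
    using affine_dependent_iff_dependent[OF z] W(2) by simp
  then have "{x. x extreme_point_of (convex hull (insert 0 W))} = insert 0 W"
    using extreme_point_of_convex_hull_affine_independent by blast
  then show ?thesis
    using simplex_mult_insert_0[OF W(1) z]
    by (simp add: mu_def Delta_def extreme_gens_pos_hull[OF W prim])
qed

section \<open>Integral vectors and half-open parallelepipeds\<close>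

lemma int_vec_0: "int_vec 0" by (simp add: int_vec_def)
lemma int_vec_add: "int_vec x \<Longrightarrow> int_vec y \<Longrightarrow> int_vec (x + y)" by (simp add: int_vec_def)
lemma int_vec_diff: "int_vec x \<Longrightarrow> int_vec y \<Longrightarrow> int_vec (x - y)" by (simp add: int_vec_def)
lemma int_vec_scale: "int_vec x \<Longrightarrow> k \<in> \<int> \<Longrightarrow> int_vec (k *\<^sub>R x)" by (simp add: int_vec_def)
lemma int_vec_sum: "(\<And>i. i \<in> I \<Longrightarrow> int_vec (f i)) \<Longrightarrow> int_vec (\<Sum>i\<in>I. f i)"
  by (induction I rule: infinite_finite_induct) (auto intro: int_vec_0 int_vec_add)

lemma int_vec_lattice_gen:
  "(\<And>w. w \<in> W \<Longrightarrow> int_vec w) \<Longrightarrow> y \<in> lattice_gen W \<Longrightarrow> int_vec y"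
  by (auto elim!: lattice_genE intro!: int_vec_sum int_vec_scale)

lemma finite_int_vec_bounded: "finite {y::real^'n. int_vec y \<and> norm y \<le> B}"
proof (rule finite_subset)
  let ?P = "PiE (UNIV::'n set) (\<lambda>_. {-\<lceil>B\<rceil>..\<lceil>B\<rceil>})"
  show "finite ((\<lambda>f. (\<chi> i. of_int (f i)) :: real^'n) ` ?P)"
    by (intro finite_imageI finite_PiE) auto
  show "{y::real^'n. int_vec y \<and> norm y \<le> B} \<subseteq> (\<lambda>f. (\<chi> i. of_int (f i)) :: real^'n) ` ?P"
  proof
    fix y :: "real^'n" assume y: "y \<in> {y. int_vec y \<and> norm y \<le> B}"
    have "\<bar>y $ i\<bar> \<le> B" for i
      using component_le_norm_cart[of y i] y by auto
    moreover have fl: "of_int \<lfloor>y $ i\<rfloor> = y $ i" for i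
      using y by (auto simp: int_vec_def elim: Ints_cases)
    ultimately have "\<bar>\<lfloor>y $ i\<rfloor>\<bar> \<le> \<lceil>B\<rceil>" for i
      by (metis of_int_abs of_int_le_iff le_of_int_ceiling order_trans)
    then have "(\<lambda>i. \<lfloor>y $ i\<rfloor>) \<in> ?P" by (auto simp: abs_le_iff minus_le_iff)
    moreover have "y = (\<chi> i. of_int \<lfloor>y $ i\<rfloor>)" by (simp add: vec_eq_iff fl)
    ultimately show "y \<in> (\<lambda>f. (\<chi> i. of_int (f i)) :: real^'n) ` ?P" by (intro image_eqI)
  qed
qed

text \<open>For constant bound 1 these are the lattice points of the half-open parallelepiped
  spanned by \<open>W\<close>. The bound may vary with the generator so that the parallelepiped can
  be cut short in one direction in \<open>lattice_index_replace\<close>.\<close>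

definition lattice_box :: "(real^'n) set \<Rightarrow> (real^'n \<Rightarrow> real) \<Rightarrow> (real^'n) set" where
  "lattice_box W b = {y. int_vec y \<and> (\<exists>c. (\<forall>w\<in>W. 0 \<le> c w \<and> c w < b w) \<and> y = (\<Sum>w\<in>W. c w *\<^sub>R w))}"

lemma finite_lattice_box: "finite (lattice_box W b)"
proof (rule finite_subset[OF _ finite_int_vec_bounded])
  show "lattice_box W b \<subseteq> {y. int_vec y \<and> norm y \<le> (\<Sum>w\<in>W. b w * norm w)}"
  proof (clarsimp simp: lattice_box_def)
    fix c assume "\<forall>w\<in>W. 0 \<le> c w \<and> c w < b w"
    then show "norm (\<Sum>w\<in>W. c w *\<^sub>R w) \<le> (\<Sum>w\<in>W. b w * norm w)"
      by (intro sum_norm_le) (auto intro!: mult_right_mono intro: less_imp_le)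
  qed
qed

lemma coset_eq_iff:
  "(\<lambda>u. x + u) ` lattice_gen W = (\<lambda>u. y + u) ` lattice_gen W \<longleftrightarrow> x - y \<in> lattice_gen W"
proof
  assume "(\<lambda>u. x + u) ` lattice_gen W = (\<lambda>u. y + u) ` lattice_gen W"
  moreover have "x + 0 \<in> (\<lambda>u. x + u) ` lattice_gen W" by (rule imageI) (rule lattice_gen_0)
  ultimately obtain u where "u \<in> lattice_gen W" "x = y + u" by auto
  then show "x - y \<in> lattice_gen W" by simp
next
  have sub: "(\<lambda>u. x + u) ` lattice_gen W \<subseteq> (\<lambda>u. y + u) ` lattice_gen W"
    if "x - y \<in> lattice_gen W" for x y
  proof
    fix z assume "z \<in> (\<lambda>u. x + u) ` lattice_gen W"
    then obtain u where u: "u \<in> lattice_gen W" "z = x + u" by blast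
    show "z \<in> (\<lambda>u. y + u) ` lattice_gen W"
      by (rule image_eqI[OF _ lattice_gen_add[OF that u(1)]]) (simp add: u(2))
  qed
  assume "x - y \<in> lattice_gen W"
  moreover from lattice_gen_uminus[OF this] have "y - x \<in> lattice_gen W" by simp
  ultimately show "(\<lambda>u. x + u) ` lattice_gen W = (\<lambda>u. y + u) ` lattice_gen W"
    using sub by blast
qed

text \<open>For an upper bound it is enough to hit every coset; several elements of \<open>R\<close>
  may represent the same one.\<close>

lemma lattice_index_le:
  fixes W :: "(real^'n) set"
  assumes "span W = UNIV" "finite R"
    and "\<And>y. int_vec y \<Longrightarrow> \<exists>r\<in>R. y - r \<in> lattice_gen W"
  shows "lattice_index W \<le> card R"
proof -
  let ?co = "\<lambda>x. (\<lambda>u. x + u) ` lattice_gen W"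
  have "?co ` saturation W \<subseteq> ?co ` R"
  proof
    fix z assume "z \<in> ?co ` saturation W"
    then obtain y where "int_vec y" "z = ?co y" by (auto simp: saturation_def)
    moreover obtain r where "r \<in> R" "y - r \<in> lattice_gen W" using assms(3) \<open>int_vec y\<close> by blast
    ultimately show "z \<in> ?co ` R" using coset_eq_iff[of y W r] by auto
  qed
  then have "card (?co ` saturation W) \<le> card (?co ` R)"
    using assms(2) by (intro card_mono) auto
  then show ?thesis
    unfolding lattice_index_def using card_image_le[OF assms(2), of ?co] by linarith
qed

text \<open>Subtracting the integer parts of the coordinates leaves the fractional parts, which lie
  in the half-open unit interval.\<close>

lemma lattice_box_repr:
  fixes W :: "(real^'n) set"
  assumes W: "finite W" "span W = UNIV" "\<And>w. w \<in> W \<Longrightarrow> int_vec w" and "int_vec y"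
  shows "\<exists>r\<in>lattice_box W (\<lambda>_. 1). y - r \<in> lattice_gen W"
proof -
  obtain c where c: "y = (\<Sum>w\<in>W. c w *\<^sub>R w)" using obtain_comb[OF W(1,2)] by blast
  define l where "l = (\<Sum>w\<in>W. of_int \<lfloor>c w\<rfloor> *\<^sub>R w)"
  have l: "l \<in> lattice_gen W" unfolding l_def by (rule lattice_genI[OF _ refl]) simp
  have "y - l = (\<Sum>w\<in>W. frac (c w) *\<^sub>R w)"
    unfolding c l_def frac_def by (simp add: scaleR_diff_left sum_subtractf)
  moreover have "int_vec (y - l)" using int_vec_lattice_gen[OF W(3) l] assms(4) int_vec_diff by blast
  ultimately have "y - l \<in> lattice_box W (\<lambda>_. 1)"
    unfolding lattice_box_def by (auto intro!: exI[of _ "\<lambda>w. frac (c w)"] frac_lt_1)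
  then show ?thesis using l by (intro bexI[of _ "y - l"]) auto
qed

text \<open>The box meets each coset exactly once: two congruent box points have coordinates that
  differ by integers of absolute value below 1, hence by 0.\<close>

lemma lattice_index_eq_card_box:
  fixes W :: "(real^'n) set"
  assumes W: "finite W" "independent W" "span W = UNIV" "\<And>w. w \<in> W \<Longrightarrow> int_vec w"
  shows "lattice_index W = card (lattice_box W (\<lambda>_. 1))"
proof (rule antisym)
  show "lattice_index W \<le> card (lattice_box W (\<lambda>_. 1))"
    using lattice_box_repr[OF W(1,3,4)] by (intro lattice_index_le W finite_lattice_box) auto
  let ?co = "\<lambda>x. (\<lambda>u. x + u) ` lattice_gen W"
  let ?B = "lattice_box W (\<lambda>_. 1)"
  have "inj_on ?co ?B"
  proof
    fix x y assume "x \<in> ?B" "y \<in> ?B" "?co x = ?co y"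
    then have d: "x - y \<in> lattice_gen W" using coset_eq_iff by blast
    obtain a b where a: "\<And>w. w \<in> W \<Longrightarrow> 0 \<le> a w \<and> a w < 1" "x = (\<Sum>w\<in>W. a w *\<^sub>R w)"
      and b: "\<And>w. w \<in> W \<Longrightarrow> 0 \<le> b w \<and> b w < 1" "y = (\<Sum>w\<in>W. b w *\<^sub>R w)"
      using \<open>x \<in> ?B\<close> \<open>y \<in> ?B\<close> unfolding lattice_box_def by auto
    obtain k where k: "\<And>w. w \<in> W \<Longrightarrow> k w \<in> \<int>" "x - y = (\<Sum>w\<in>W. k w *\<^sub>R w)"
      using d by (elim lattice_genE) blast
    have "(\<Sum>w\<in>W. (a w - b w) *\<^sub>R w) = (\<Sum>w\<in>W. k w *\<^sub>R w)"
      using k(2) unfolding a(2) b(2) by (simp add: scaleR_diff_left sum_subtractf)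
    then have ab: "a w - b w = k w" if "w \<in> W" for w
      using comb_unique[OF W(1,2) _ that, of "\<lambda>w. a w - b w" k] by simp
    have "a w = b w" if w: "w \<in> W" for w
    proof -
      obtain j where "k w = of_int j" using k(1)[OF w] Ints_cases by metis
      moreover have "\<bar>k w\<bar> < 1" using ab[OF w] a(1)[OF w] b(1)[OF w] by auto
      ultimately have "j = 0" by linarith
      then show ?thesis using ab[OF w] \<open>k w = of_int j\<close> by simp
    qed
    then show "x = y" unfolding a(2) b(2) by simp
  qed
  then have "card ?B = card (?co ` ?B)" by (simp add: card_image)
  also have "\<dots> \<le> card (?co ` saturation W)"
  \<comment> \<open>An infinite set would have \<open>card\<close> 0, so the set of cosets must be
    shown finite first; the box represents all of them.\<close>
  proof (rule card_mono)
    have "?co ` saturation W \<subseteq> ?co ` ?B"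
    proof
      fix z assume "z \<in> ?co ` saturation W"
      then obtain y where "int_vec y" "z = ?co y" by (auto simp: saturation_def)
      moreover obtain r where "r \<in> ?B" "y - r \<in> lattice_gen W"
        using lattice_box_repr[OF W(1,3,4) \<open>int_vec y\<close>] by blast
      ultimately show "z \<in> ?co ` ?B" using coset_eq_iff[of y W r] by auto
    qed
    then show "finite (?co ` saturation W)" using finite_lattice_box finite_surj by blast
    show "?co ` ?B \<subseteq> ?co ` saturation W"
      by (intro image_mono) (auto simp: lattice_box_def saturation_def W(3))
  qed
  finally show "card ?B \<le> lattice_index W" unfolding lattice_index_def .
qed

lemma zero_in_lattice_box: "0 \<in> lattice_box W (\<lambda>_. 1)"
  unfolding lattice_box_def using int_vec_0 by (auto intro!: exI[of _ "\<lambda>_. 0"])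

lemma lattice_index_1_iff:
  fixes W :: "(real^'n) set"
  assumes W: "finite W" "independent W" "span W = UNIV" "\<And>w. w \<in> W \<Longrightarrow> int_vec w"
  shows "lattice_index W = 1 \<longleftrightarrow> lattice_box W (\<lambda>_. 1) = {0}"
proof
  assume "lattice_index W = 1"
  then have "card (lattice_box W (\<lambda>_. 1)) = 1" using lattice_index_eq_card_box[OF assms] by simp
  then obtain z where "lattice_box W (\<lambda>_. 1) = {z}" by (rule card_1_singletonE)
  then show "lattice_box W (\<lambda>_. 1) = {0}" using zero_in_lattice_box[of W] by simp
qed (simp add: lattice_index_eq_card_box[OF assms])

lemma lattice_gen_unimodular:
  fixes W :: "(real^'n) set"
  assumes W: "finite W" "independent W" "span W = UNIV" "\<And>w. w \<in> W \<Longrightarrow> int_vec w"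
    and "lattice_index W = 1"
  shows "lattice_gen W = {x. int_vec x}"
proof -
  have "lattice_box W (\<lambda>_. 1) = {0}" using lattice_index_1_iff[OF W] assms(5) by blast
  then show ?thesis
    using lattice_box_repr[OF W(1,3,4)] int_vec_lattice_gen[OF W(4)] by auto
qed

text \<open>The cosets of the new lattice have representatives in the subset of the old half-open
  parallelepiped where the coordinate at \<open>v\<close> is below \<open>\<xi> v\<close>, and this subset misses \<open>x\<close>.\<close>
lemma lattice_index_replace:
  fixes W :: "(real^'n) set"
  assumes W: "finite W" "independent W" "span W = UNIV" "\<And>w. w \<in> W \<Longrightarrow> int_vec w"
    and x: "int_vec x" "x = (\<Sum>w\<in>W. \<xi> w *\<^sub>R w)" "\<And>w. w \<in> W \<Longrightarrow> 0 \<le> \<xi> w \<and> \<xi> w < 1"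
    and v: "v \<in> W" "0 < \<xi> v"
  shows "lattice_index (insert x (W - {v})) < lattice_index W"
proof -
  let ?W = "insert x (W - {v})"
  let ?B = "lattice_box W (\<lambda>_. 1)" and ?B' = "lattice_box W ((\<lambda>_. 1)(v := \<xi> v))"
  \<comment> \<open>Solving the expansion of \<open>x\<close> for \<open>v\<close>, possible because
    its coefficient is positive, shows that the new family still spans.\<close>
  have xv: "\<xi> v *\<^sub>R v = x - (\<Sum>w\<in>W-{v}. \<xi> w *\<^sub>R w)"
    unfolding x(2) using sum.remove[OF W(1) v(1), of "\<lambda>w. \<xi> w *\<^sub>R w"] by simp
  have "\<xi> v *\<^sub>R v \<in> span ?W"
    unfolding xv by (intro span_diff span_sum span_mul) (auto intro: span_base)
  then have "(1 / \<xi> v) *\<^sub>R (\<xi> v *\<^sub>R v) \<in> span ?W" by (rule span_mul)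
  then have "v \<in> span ?W" using v(2) by simp
  then have "W \<subseteq> span ?W" by (auto intro: span_base)
  then have sp: "span ?W = UNIV" using span_minimal[OF _ subspace_span] W(3) by blast
  have "lattice_index ?W \<le> card ?B'"
  proof (rule lattice_index_le[OF sp finite_lattice_box])
    fix y :: "real^'n" assume y: "int_vec y"
    obtain c where c: "y = (\<Sum>w\<in>W. c w *\<^sub>R w)" using obtain_comb[OF W(1,3)] by blast
    \<comment> \<open>Subtracting \<open>k\<close> copies of \<open>x\<close> reduces the coordinate
      at \<open>v\<close> modulo \<open>\<xi> v\<close>. The other coordinates are then reduced
      modulo 1, using generators that survive the replacement.\<close>
    define k :: real where "k = of_int \<lfloor>c v / \<xi> v\<rfloor>"
    define e where "e = (\<lambda>w. c w - k * \<xi> w)"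
    define l where "l = k *\<^sub>R x + (\<Sum>w\<in>W-{v}. of_int \<lfloor>e w\<rfloor> *\<^sub>R w)"
    have fin: "finite ?W" using W(1) by simp
    have l: "l \<in> lattice_gen ?W" unfolding l_def k_def
      by (intro lattice_gen_add lattice_gen_sum lattice_gen_scale lattice_gen_base[OF fin]) auto
    have "int_vec w" if "w \<in> ?W" for w using that W(4) x(1) by auto
    then have il: "int_vec (y - l)" using int_vec_lattice_gen[OF _ l] y int_vec_diff by blast
    have "y - k *\<^sub>R x = (\<Sum>w\<in>W. e w *\<^sub>R w)"
      unfolding c x(2) e_def by (simp add: scaleR_diff_left sum_subtractf scaleR_sum_right)
    also have "\<dots> = e v *\<^sub>R v + (\<Sum>w\<in>W-{v}. e w *\<^sub>R w)" using sum.remove[OF W(1) v(1)] .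
    finally have "y - l = e v *\<^sub>R v + (\<Sum>w\<in>W-{v}. frac (e w) *\<^sub>R w)"
      unfolding l_def by (simp add: frac_def scaleR_diff_left sum_subtractf algebra_simps)
    also have "\<dots> = (\<Sum>w\<in>W. (if w = v then e v else frac (e w)) *\<^sub>R w)"
      by (subst sum.remove[OF W(1) v(1)]) (auto intro!: sum.cong)
    finally have yl: "y - l = (\<Sum>w\<in>W. (if w = v then e v else frac (e w)) *\<^sub>R w)" .
    have "k \<le> c v / \<xi> v" "c v / \<xi> v < k + 1" unfolding k_def by linarith+
    then have "0 \<le> e v" "e v < \<xi> v" unfolding e_def using v(2) by (auto simp: field_simps)
    then have "y - l \<in> ?B'"
      unfolding lattice_box_def using il yl
      by (auto intro!: exI[of _ "\<lambda>w. if w = v then e v else frac (e w)"] frac_lt_1)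
    then show "\<exists>r\<in>?B'. y - r \<in> lattice_gen ?W" using l by (intro bexI[of _ "y - l"]) auto
  qed
  also have "card ?B' < card ?B"
  proof (rule psubset_card_mono[OF finite_lattice_box])
    have "?B' \<subseteq> ?B"
    proof
      fix z assume "z \<in> ?B'"
      then obtain c where c: "int_vec z" "\<forall>w\<in>W. 0 \<le> c w \<and> c w < ((\<lambda>_. 1)(v := \<xi> v)) w" "z = (\<Sum>w\<in>W. c w *\<^sub>R w)"
        unfolding lattice_box_def by auto
      have "\<forall>w\<in>W. 0 \<le> c w \<and> c w < 1" using c(2) x(3)[OF v(1)] by (fastforce split: if_splits)
      then show "z \<in> ?B" unfolding lattice_box_def using c by blast
    qed
    moreover have "x \<in> ?B" unfolding lattice_box_def using x by blast
    moreover have "x \<notin> ?B'"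
    proof
      assume "x \<in> ?B'"
      then obtain c where c: "\<forall>w\<in>W. 0 \<le> c w \<and> c w < ((\<lambda>_. 1)(v := \<xi> v)) w" "x = (\<Sum>w\<in>W. c w *\<^sub>R w)"
        unfolding lattice_box_def by auto
      have "\<xi> v = c v" by (rule comb_unique[OF W(1,2) trans[OF x(2)[symmetric] c(2)] v(1)])
      then show False using c(1) v(1) by auto
    qed
    ultimately show "?B' \<subset> ?B" by blast
  qed
  finally show ?thesis using lattice_index_eq_card_box[OF W] by simp
qed

section \<open>Hilbert bases and primitive generators\<close>

text \<open>A lattice point has integral coordinates over \<open>W\<close>, whereas
  \<open>t *\<^sub>R w\<close> has the coordinate \<open>t\<close> strictly between 0 and 1.\<close>

lemma primitive_unimodular:
  fixes W :: "(real^'n) set"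
  assumes W: "finite W" "independent W" "lattice_gen W = {x. int_vec x}" "w \<in> W"
  shows "primitive w"
  unfolding primitive_def
proof (intro conjI allI impI notI)
  show "int_vec w" using lattice_gen_base[OF W(1,4)] W(3) by blast
  fix t :: real assume t: "0 < t \<and> t < 1" "int_vec (t *\<^sub>R w)"
  then have "t *\<^sub>R w \<in> lattice_gen W" using W(3) by blast
  then obtain k where k: "\<And>w. w \<in> W \<Longrightarrow> k w \<in> \<int>" "t *\<^sub>R w = (\<Sum>w\<in>W. k w *\<^sub>R w)"
    by (elim lattice_genE) blast
  have "t *\<^sub>R w = (\<Sum>u\<in>W. (if u = w then t else 0) *\<^sub>R u)"
    using comb_delta[OF W(1,4)] by simp
  then have "t = k w" using comb_unique[OF W(1,2), of "\<lambda>u. if u = w then t else 0" k w] k(2) W(4) by simp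
  then show False using k(1)[OF W(4)] t(1) by (auto elim!: Ints_cases)
qed

text \<open>A lattice point of the cone has one nonnegative and one integral expansion over
  \<open>W\<close>. By independence they agree, so the coordinates are natural numbers.\<close>

lemma monoid_gen_self:
  assumes W: "finite W" "independent W" "lattice_gen W = {x. int_vec x}"
  shows "monoid_gen W = pos_hull W \<inter> {x. int_vec x}"
proof (intro equalityI subsetI)
  fix y assume "y \<in> monoid_gen W"
  then obtain F k where F: "finite F" "F \<subseteq> W" "y = (\<Sum>h\<in>F. real (k h :: nat) *\<^sub>R h)"
    unfolding monoid_gen_def by blast
  then have "y \<in> pos_hull F" by (intro pos_hullI[of F "\<lambda>h. real (k h)"]) auto
  moreover have "y \<in> lattice_gen W" unfolding F(3)
    using F(2) by (intro lattice_gen_sum lattice_gen_scale lattice_gen_base[OF W(1)]) auto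
  ultimately show "y \<in> pos_hull W \<inter> {x. int_vec x}" using W(3) pos_hull_mono[OF W(1) F(2)] by blast
next
  fix y assume y: "y \<in> pos_hull W \<inter> {x. int_vec x}"
  then obtain c where c: "\<And>v. v \<in> W \<Longrightarrow> 0 \<le> c v" "y = (\<Sum>v\<in>W. c v *\<^sub>R v)"
    by (elim IntE pos_hullE) blast
  from y have "y \<in> lattice_gen W" using W(3) by blast
  then obtain k where k: "\<And>w. w \<in> W \<Longrightarrow> k w \<in> \<int>" "y = (\<Sum>w\<in>W. k w *\<^sub>R w)"
    by (elim lattice_genE) blast
  have "k w = real (nat \<lfloor>k w\<rfloor>)" if "w \<in> W" for w
  proof -
    have "c w = k w" by (rule comb_unique[OF W(1,2) trans[OF c(2)[symmetric] k(2)] that])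
    then show ?thesis using c(1)[OF that] k(1)[OF that] by (auto elim!: Ints_cases)
  qed
  then have "y = (\<Sum>w\<in>W. real (nat \<lfloor>k w\<rfloor>) *\<^sub>R w)" unfolding k(2) by (intro sum.cong) auto
  then show "y \<in> monoid_gen W"
    unfolding monoid_gen_def using W(1)
    by (intro CollectI exI[of _ W] exI[of _ "\<lambda>w. nat \<lfloor>k w\<rfloor>"]) auto
qed

text \<open>Each element of \<open>W\<close> is irreducible in the monoid, hence belongs to every generating set.\<close>
lemma generators_in_generating_set:
  assumes W: "finite W" "independent W" "lattice_gen W = {x. int_vec x}"
    and H: "H \<subseteq> pos_hull W \<inter> {x. int_vec x}" "w \<in> monoid_gen H" "w \<in> W"
  shows "w \<in> H"
proof -
  obtain F k where F: "finite F" "F \<subseteq> H" "w = (\<Sum>h\<in>F. real (k h :: nat) *\<^sub>R h)"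
    using H(2) unfolding monoid_gen_def by blast
  have "\<exists>n. h = (\<Sum>w\<in>W. real (n w :: nat) *\<^sub>R w)" if "h \<in> H" for h
  proof -
    have "h \<in> monoid_gen W" using that H(1) monoid_gen_self[OF W] by blast
    then obtain G n where G: "finite G" "G \<subseteq> W" "h = (\<Sum>g\<in>G. real (n g :: nat) *\<^sub>R g)"
      unfolding monoid_gen_def by blast
    have "h = (\<Sum>w\<in>W. real (if w \<in> G then n w else 0) *\<^sub>R w)"
      unfolding G(3) using G W(1) by (intro sum.mono_neutral_cong_left) auto
    then show ?thesis by (rule exI[of _ "\<lambda>w. if w \<in> G then n w else 0"])
  qed
  then obtain n where n: "\<And>h. h \<in> H \<Longrightarrow> h = (\<Sum>w\<in>W. real (n h w :: nat) *\<^sub>R w)" by metis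
  have "w = (\<Sum>h\<in>F. real (k h) *\<^sub>R (\<Sum>u\<in>W. real (n h u) *\<^sub>R u))"
    unfolding F(3) using F(2) n by (intro sum.cong refl) (metis subsetD)
  also have "\<dots> = (\<Sum>u\<in>W. real (\<Sum>h\<in>F. k h * n h u) *\<^sub>R u)"
    unfolding scaleR_sum_right by (subst sum.swap) (simp add: scaleR_sum_left)
  finally have "(\<Sum>u\<in>W. (if u = w then 1 else 0) *\<^sub>R u) = (\<Sum>u\<in>W. real (\<Sum>h\<in>F. k h * n h u) *\<^sub>R u)"
    using comb_single[OF W(1) H(3)] by simp
  note eq = comb_unique[OF W(1,2) this]
  have "real (if u = w then 1 else 0) = real (\<Sum>h\<in>F. k h * n h u)" if "u \<in> W" for u
    by (rule trans[OF _ eq[OF that]]) simp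
  then have co: "(if u = w then 1 else 0) = (\<Sum>h\<in>F. k h * n h u)" if "u \<in> W" for u
    using that unfolding of_nat_eq_iff by blast
  \<comment> \<open>The coordinate of \<open>w\<close> at itself is 1, so some summand
    \<open>h\<close> involves \<open>w\<close>. The natural coefficients admit no cancellation:
    \<open>h\<close> has no other coordinates, and its coordinate at \<open>w\<close> is 1.\<close>
  have "\<exists>h\<in>F. k h * n h w \<noteq> 0"
    using co[OF H(3)] by (metis (mono_tags, lifting) sum.neutral zero_neq_one)
  then obtain h where h: "h \<in> F" "k h \<noteq> 0" "n h w \<noteq> 0" by auto
  have n0: "n h u = 0" if "u \<in> W" "u \<noteq> w" for u
  proof -
    have "(\<Sum>h\<in>F. k h * n h u) = 0" using co[OF that(1)] that(2) by simp
    then have "k h * n h u = 0" using F(1) h(1) by simp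
    then show ?thesis using h(2) by simp
  qed
  have n1: "n h w = 1"
  proof -
    have "k h * n h w \<le> 1" using co[OF H(3)] member_le_sum[of h F "\<lambda>h. k h * n h w"] F(1) h(1) by simp
    moreover have "n h w \<le> k h * n h w" using h(2) by simp
    ultimately show ?thesis using h(3) by linarith
  qed
  have "h = (\<Sum>u\<in>W. real (n h u) *\<^sub>R u)" by (rule n) (use h(1) F(2) in blast)
  also have "\<dots> = (\<Sum>u\<in>W. (if u = w then 1 else 0) *\<^sub>R u)"
    using n0 n1 by (intro sum.cong) auto
  also have "\<dots> = w" using comb_single[OF W(1) H(3)] by simp
  finally have "h = w" .
  then show ?thesis using h(1) F(2) by blast
qed

text \<open>\<open>W\<close> generates the monoid and is contained in every generating set. It is
  thus the only minimal one, which makes the definite description well defined.\<close>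

lemma hilb_unimodular:
  assumes W: "finite W" "independent W" "lattice_gen W = {x. int_vec x}"
  shows "hilb (pos_hull W) = W"
  unfolding hilb_def
proof (rule the_equality)
  let ?M = "pos_hull W \<inter> {x. int_vec x}"
  have sub: "W \<subseteq> ?M"
    using pos_hull_base[OF W(1)] lattice_gen_base[OF W(1)] W(3) by blast
  have key: "W \<subseteq> H" if "H \<subseteq> ?M" "monoid_gen H = ?M" for H
    using generators_in_generating_set[OF W that(1)] that(2) sub by blast
  have "monoid_gen H' \<noteq> ?M" if "H' \<subset> W" for H'
    using key[of H'] that sub by blast
  then show "W \<subseteq> ?M \<and> monoid_gen W = ?M \<and> (\<forall>H'. H' \<subset> W \<longrightarrow> monoid_gen H' \<noteq> ?M)"
    using sub monoid_gen_self[OF W] by blast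
  fix H assume H: "H \<subseteq> ?M \<and> monoid_gen H = ?M \<and> (\<forall>H'. H' \<subset> H \<longrightarrow> monoid_gen H' \<noteq> ?M)"
  then have "W \<subseteq> H" using key by blast
  then show "H = W" using H monoid_gen_self[OF W] by blast
qed

section \<open>Primitive generators of a rational simplicial cone\<close>

text \<open>Multiplying by the product of the denominators gives an integral vector
  \<open>v0\<close>. Only finitely many integral vectors lie on the segment from 0 to
  \<open>v0\<close>; a shortest nonzero one is primitive.\<close>

lemma obtain_primitive_multiple:
  fixes v :: "real^'n"
  assumes "rat_vec v" "v \<noteq> 0"
  obtains t where "t > 0" "primitive (t *\<^sub>R v)"
proof -
  have "\<exists>q::int. q > 0 \<and> of_int q * v $ i \<in> \<int>" for i
  proof -
    have "v $ i \<in> \<rat>" using assms(1) by (simp add: rat_vec_def)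
    then obtain a b :: int where "b > 0" "v $ i = of_int a / of_int b" by (elim Rats_cases') auto
    then show ?thesis by (intro exI[of _ b]) auto
  qed
  then obtain q :: "'n \<Rightarrow> int" where q: "\<And>i. q i > 0" "\<And>i. of_int (q i) * v $ i \<in> \<int>" by metis
  define Q where "Q = (\<Prod>i\<in>UNIV. q i)"
  have "Q > 0" unfolding Q_def using q(1) by (intro prod_pos) auto
  define v0 where "v0 = of_int Q *\<^sub>R v"
  have "int_vec v0"
    unfolding int_vec_def
  proof
    fix i
    have "Q = q i * (\<Prod>j\<in>UNIV-{i}. q j)" unfolding Q_def by (rule prod.remove) auto
    then have "v0 $ i = of_int (\<Prod>j\<in>UNIV-{i}. q j) * (of_int (q i) * v $ i)" unfolding v0_def by simp
    then show "v0 $ i \<in> \<int>" using q(2)[of i] by (metis Ints_mult Ints_of_int)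
  qed
  have v0: "v0 \<noteq> 0" unfolding v0_def using assms(2) \<open>Q > 0\<close> by simp
  define P where "P = {y. int_vec y \<and> (\<exists>s. 0 < s \<and> s \<le> 1 \<and> y = s *\<^sub>R v0)}"
  have fin: "finite P"
    by (rule finite_subset[OF _ finite_int_vec_bounded[of "norm v0"]]) (auto simp: P_def mult_left_le_one_le)
  have "v0 \<in> P" using \<open>int_vec v0\<close> unfolding P_def by (auto intro!: exI[of _ 1])
  then obtain y where y: "y \<in> P" "\<And>z. z \<in> P \<Longrightarrow> norm y \<le> norm z"
    using ex_min_if_finite[of "norm ` P"] fin by (metis arg_min_if_finite(1) arg_min_least empty_iff)
  obtain s where s: "0 < s" "s \<le> 1" "y = s *\<^sub>R v0" using y(1) unfolding P_def by blast
  have "primitive y"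
    unfolding primitive_def
  proof (intro conjI allI impI notI)
    show "int_vec y" using y(1) unfolding P_def by blast
    fix t :: real assume t: "0 < t \<and> t < 1" "int_vec (t *\<^sub>R y)"
    have "t * s \<le> 1" using t s by (simp add: mult_le_one)
    then have "t *\<^sub>R y \<in> P" unfolding P_def using t s by (auto intro!: exI[of _ "t * s"])
    then have "norm y \<le> t * norm y" using y(2)[of "t *\<^sub>R y"] t(1) by simp
    moreover have "norm y > 0" using s v0 by simp
    ultimately show False using t(1) by simp
  qed
  then show ?thesis using that[of "s * of_int Q"] s \<open>Q > 0\<close> unfolding v0_def by simp
qed

lemma primitive_generators:
  fixes V :: "(real^'n) set"
  assumes V: "finite V" "independent V" "\<forall>v\<in>V. rat_vec v"
  obtains U where "finite U" "independent U" "card U = card V" "\<And>u. u \<in> U \<Longrightarrow> primitive u"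
    "pos_hull U = pos_hull V"
proof -
  have "\<exists>t. t > 0 \<and> primitive (t *\<^sub>R v)" if "v \<in> V" for v
    using obtain_primitive_multiple[of v] V that dependent_zero by (metis (no_types))
  then obtain t where t: "\<And>v. v \<in> V \<Longrightarrow> t v > 0 \<and> primitive (t v *\<^sub>R v)" by metis
  let ?f = "\<lambda>v. t v *\<^sub>R v"
  \<comment> \<open>Distinct elements of an independent set are not proportional. Injectivity is
    what allows sums to be reindexed along the scaling.\<close>
  have inj: "inj_on ?f V"
  proof
    fix v w assume vw: "v \<in> V" "w \<in> V" "?f v = ?f w"
    have "(\<Sum>u\<in>V. (if u = v then t v else 0) *\<^sub>R u) = (\<Sum>u\<in>V. (if u = w then t w else 0) *\<^sub>R u)"
      using vw(3) by (simp add: comb_delta[OF V(1)] vw(1,2))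
    from comb_unique[OF V(1,2) this vw(1)] show "v = w" using t[OF vw(1)] by (auto split: if_splits)
  qed
  have red: "(\<Sum>u\<in>?f ` V. c u *\<^sub>R u) = (\<Sum>v\<in>V. (c (?f v) * t v) *\<^sub>R v)" for c
    by (simp add: sum.reindex[OF inj])
  have ind: "independent (?f ` V)"
  proof (rule independent_if_scalars_zero)
    show "finite (?f ` V)" using V(1) by simp
    fix c u assume c: "(\<Sum>u\<in>?f ` V. c u *\<^sub>R u) = 0" "u \<in> ?f ` V"
    then obtain v where "v \<in> V" "u = ?f v" by blast
    moreover have "(\<Sum>v\<in>V. (c (?f v) * t v) *\<^sub>R v) = (\<Sum>v\<in>V. 0 *\<^sub>R v)" using c(1) red by simp
    ultimately have "c u * t v = 0" using comb_unique[OF V(1,2), of "\<lambda>v. c (?f v) * t v" "\<lambda>_. 0" v] by simp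
    then show "c u = 0" using t[OF \<open>v \<in> V\<close>] by simp
  qed
  have "pos_hull (?f ` V) = pos_hull V"
  proof (intro equalityI subsetI)
    fix y assume "y \<in> pos_hull (?f ` V)"
    then obtain c where c: "\<And>u. u \<in> ?f ` V \<Longrightarrow> 0 \<le> c u" "y = (\<Sum>u\<in>?f ` V. c u *\<^sub>R u)"
      by (elim pos_hullE) blast
    show "y \<in> pos_hull V"
      using c(1) t unfolding c(2) red
      by (intro pos_hullI[OF _ refl]) (simp add: less_imp_le)
  next
    fix y assume "y \<in> pos_hull V"
    then obtain c where c: "\<And>v. v \<in> V \<Longrightarrow> 0 \<le> c v" "y = (\<Sum>v\<in>V. c v *\<^sub>R v)"
      by (elim pos_hullE) blast
    have "y = (\<Sum>v\<in>V. (c v / t v) *\<^sub>R ?f v)" unfolding c(2)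
      using t by (intro sum.cong) (auto simp: less_le)
    then have y: "y = (\<Sum>u\<in>?f ` V. (c (inv_into V ?f u) / t (inv_into V ?f u)) *\<^sub>R u)"
      by (simp add: sum.reindex[OF inj] inv_into_f_f[OF inj])
    show "y \<in> pos_hull (?f ` V)"
      by (rule pos_hullI[OF _ y]) (use c(1) t in \<open>auto simp: inv_into_f_f[OF inj] less_imp_le\<close>)
  qed
  then show ?thesis using that[of "?f ` V"] V(1) ind t by (simp add: card_image[OF inj] image_iff) blast
qed

section \<open>Stellar subdivision\<close>

text \<open>Equivalently, every member is linearly independent and any two of the cones meet in the cone
  over the common generators.\<close>
definition compatible :: "(real^'n) set set \<Rightarrow> bool" where
  "compatible \<W> \<longleftrightarrow> (\<forall>A\<in>\<W>. \<forall>B\<in>\<W>. \<forall>a b.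
     (\<forall>w. 0 \<le> a w) \<longrightarrow> (\<forall>w. 0 \<le> b w) \<longrightarrow> (\<forall>w. w \<notin> A \<longrightarrow> a w = 0) \<longrightarrow> (\<forall>w. w \<notin> B \<longrightarrow> b w = 0) \<longrightarrow>
     (\<Sum>w\<in>A. a w *\<^sub>R w) = (\<Sum>w\<in>B. b w *\<^sub>R w) \<longrightarrow> a = b)"

lemma compatibleD:
  assumes "compatible \<W>" "A \<in> \<W>" "B \<in> \<W>" "\<And>w. 0 \<le> a w" "\<And>w. 0 \<le> b w"
    "\<And>w. w \<notin> A \<Longrightarrow> a w = 0" "\<And>w. w \<notin> B \<Longrightarrow> b w = 0"
    "(\<Sum>w\<in>A. a w *\<^sub>R w) = (\<Sum>w\<in>B. b w *\<^sub>R w)"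
  shows "a = b"
  using assms unfolding compatible_def by blast

lemma compatible_singleton:
  fixes W :: "(real^'n) set"
  assumes W: "finite W" "independent W"
  shows "compatible {W}"
  unfolding compatible_def
proof (intro ballI allI impI ext)
  fix A B and a b :: "real^'n \<Rightarrow> real" and w
  assume "A \<in> {W}" "B \<in> {W}" "\<forall>w. w \<notin> A \<longrightarrow> a w = 0" "\<forall>w. w \<notin> B \<longrightarrow> b w = 0"
    "(\<Sum>w\<in>A. a w *\<^sub>R w) = (\<Sum>w\<in>B. b w *\<^sub>R w)"
  then show "a w = b w" using comb_unique[OF W, of a b w] by (cases "w \<in> W") auto
qed

text \<open>The positive and the negative part of a vanishing combination represent the same point
  with nonnegative coefficients. By compatibility they are equal, and since at each vector one of
  them is 0, both vanish.\<close>

lemma compatible_independent: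
  assumes "compatible \<W>" "A \<in> \<W>" "finite A"
  shows "independent A"
proof (rule independent_if_scalars_zero[OF assms(3)])
  fix f v assume f: "(\<Sum>x\<in>A. f x *\<^sub>R x) = 0" and v: "v \<in> A"
  let ?a = "\<lambda>w. if w \<in> A then max 0 (f w) else 0"
  let ?b = "\<lambda>w. if w \<in> A then max 0 (- f w) else 0"
  have "(\<Sum>w\<in>A. ?a w *\<^sub>R w) - (\<Sum>w\<in>A. ?b w *\<^sub>R w) = (\<Sum>w\<in>A. f w *\<^sub>R w)"
    unfolding sum_subtractf[symmetric] scaleR_diff_left[symmetric]
    by (intro sum.cong) (auto simp: max_def)
  then have "?a = ?b" using f by (intro compatibleD[OF assms(1,2,2)]) auto
  from fun_cong[OF this, of v] show "f v = 0" using v by (auto simp: max_def split: if_splits)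
qed

text \<open>A common point has the same coefficients over \<open>A\<close> and over
  \<open>B\<close>, so they are supported on \<open>A \<inter> B\<close>.\<close>

lemma compatible_Int:
  assumes "compatible \<W>" "A \<in> \<W>" "B \<in> \<W>" "finite A" "finite B"
  shows "pos_hull A \<inter> pos_hull B = pos_hull (A \<inter> B)"
proof (intro equalityI subsetI)
  fix y assume "y \<in> pos_hull A \<inter> pos_hull B"
  then obtain a b where a: "\<And>v. v \<in> A \<Longrightarrow> 0 \<le> a v" "y = (\<Sum>v\<in>A. a v *\<^sub>R v)"
    and b: "\<And>v. v \<in> B \<Longrightarrow> 0 \<le> b v" "y = (\<Sum>v\<in>B. b v *\<^sub>R v)"
    by (elim IntE pos_hullE) blast
  let ?a = "\<lambda>w. if w \<in> A then a w else 0" and ?b = "\<lambda>w. if w \<in> B then b w else 0"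
  have "(\<Sum>w\<in>A. ?a w *\<^sub>R w) = (\<Sum>w\<in>B. ?b w *\<^sub>R w)" using a(2) b(2) by simp
  then have ab: "?a = ?b" using a(1) b(1) by (intro compatibleD[OF assms(1,2,3)]) auto
  have "a w = 0" if "w \<in> A - B" for w using fun_cong[OF ab, of w] that by simp
  then have "y = (\<Sum>v\<in>A\<inter>B. a v *\<^sub>R v)"
    unfolding a(2) using assms(4) by (intro sum.mono_neutral_right) auto
  then show "y \<in> pos_hull (A \<inter> B)" using a(1) by (intro pos_hullI[of _ a]) auto
next
  fix y assume "y \<in> pos_hull (A \<inter> B)"
  then show "y \<in> pos_hull A \<inter> pos_hull B"
    using pos_hull_mono[OF assms(4), of "A \<inter> B"] pos_hull_mono[OF assms(5), of "A \<inter> B"] by auto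
qed

text \<open>In the application \<open>x\<close> is a positive combination of \<open>F\<close>, and
  compatibility makes the sets containing \<open>F\<close> precisely those whose cone contains
  \<open>x\<close>.\<close>

definition stellar :: "(real^'n) set set \<Rightarrow> (real^'n) set \<Rightarrow> real^'n \<Rightarrow> (real^'n) set set" where
  "stellar \<W> F x = {W\<in>\<W>. \<not> F \<subseteq> W} \<union> (\<lambda>(W, v). insert x (W - {v})) ` ({W\<in>\<W>. F \<subseteq> W} \<times> F)"

lemma stellar_cases:
  assumes "A \<in> stellar \<W> F x"
  obtains "A \<in> \<W>" "\<not> F \<subseteq> A"
  | W v where "W \<in> \<W>" "F \<subseteq> W" "v \<in> F" "A = insert x (W - {v})"
  using assms unfolding stellar_def by auto

text \<open>Old coordinates are recovered from new ones by substituting \<open>x\<close>; the coefficient of \<open>x\<close> is then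
  determined by the vanishing of some coordinate in \<open>F\<close>, which holds in every cone after
  subdivision.\<close>
lemma compatible_stellar:
  fixes \<xi> :: "real^'n \<Rightarrow> real"
  assumes comp: "compatible \<W>" and fin: "\<And>W. W \<in> \<W> \<Longrightarrow> finite W"
    and \<xi>: "\<And>w. 0 \<le> \<xi> w" "\<And>w. \<xi> w > 0 \<longleftrightarrow> w \<in> F"
    and x: "x = (\<Sum>w\<in>F. \<xi> w *\<^sub>R w)" "x \<notin> \<Union>\<W>" "x \<notin> F"
  shows "compatible (stellar \<W> F x)"
proof -
  have \<xi>0: "\<xi> w = 0" if "w \<notin> F" for w using \<xi>(1)[of w] \<xi>(2)[of w] that by auto
  \<comment> \<open>Coefficients over the old generators after expanding \<open>x\<close> in terms
    of \<open>F\<close>. The entry at \<open>x\<close> is 0 because \<open>x\<close> is not an old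
    generator.\<close>
  let ?old = "\<lambda>a w. if w = x then 0 else a w + a x * \<xi> w"
  have old: "\<exists>W\<in>\<W>. (\<forall>w. w \<notin> W \<longrightarrow> ?old a w = 0) \<and>
        (\<Sum>w\<in>W. ?old a w *\<^sub>R w) = (\<Sum>w\<in>A. a w *\<^sub>R w) \<and> (\<exists>f\<in>F. a f = 0)"
    if A: "A \<in> stellar \<W> F x" and a: "\<And>w. w \<notin> A \<Longrightarrow> a w = 0" for A a
    using A
  proof (cases rule: stellar_cases)
    case 1
    then have ax: "a x = 0" using x(2) a by auto
    obtain f where "f \<in> F" "f \<notin> A" using 1 by blast
    then show ?thesis using 1 a ax by (intro bexI[of _ A]) (auto intro!: sum.cong)
  next
    case (2 W v)
    have xW: "x \<notin> W" using 2 x(2) by blast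
    have "v \<noteq> x" using 2 xW by blast
    then have av: "a v = 0" using a 2 by blast
    have fW: "finite W" using fin 2 by blast
    have "(\<Sum>w\<in>A. a w *\<^sub>R w) = a x *\<^sub>R x + (\<Sum>w\<in>W-{v}. a w *\<^sub>R w)"
      unfolding 2(4) using xW fW by (subst sum.insert) auto
    also have "(\<Sum>w\<in>W-{v}. a w *\<^sub>R w) = (\<Sum>w\<in>W. a w *\<^sub>R w)"
      using fW av by (intro sum.mono_neutral_left) auto
    also have "a x *\<^sub>R x = (\<Sum>w\<in>W. (a x * \<xi> w) *\<^sub>R w)"
    proof -
      have "x = (\<Sum>w\<in>W. \<xi> w *\<^sub>R w)"
        unfolding x(1) using fW 2 \<xi>0 by (intro sum.mono_neutral_left) auto
      then have "a x *\<^sub>R x = a x *\<^sub>R (\<Sum>w\<in>W. \<xi> w *\<^sub>R w)" by simp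
      then show ?thesis by (simp add: scaleR_sum_right)
    qed
    also have "\<dots> + (\<Sum>w\<in>W. a w *\<^sub>R w) = (\<Sum>w\<in>W. ?old a w *\<^sub>R w)"
      unfolding sum.distrib[symmetric] using xW by (intro sum.cong) (auto simp: scaleR_add_left)
    finally have "(\<Sum>w\<in>W. ?old a w *\<^sub>R w) = (\<Sum>w\<in>A. a w *\<^sub>R w)" ..
    moreover have "?old a w = 0" if "w \<notin> W" for w
      using that a[of w] \<xi>0[of w] 2 by auto
    ultimately show ?thesis using 2 av by (intro bexI[of _ W]) auto
  qed
  show ?thesis
    unfolding compatible_def
  proof (intro ballI allI impI)
    fix A B and a b :: "real^'n \<Rightarrow> real"
    assume A: "A \<in> stellar \<W> F x" and B: "B \<in> stellar \<W> F x"
      and a0: "\<forall>w. 0 \<le> a w" and b0: "\<forall>w. 0 \<le> b w"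
      and aA: "\<forall>w. w \<notin> A \<longrightarrow> a w = 0" and bB: "\<forall>w. w \<notin> B \<longrightarrow> b w = 0"
      and eq: "(\<Sum>w\<in>A. a w *\<^sub>R w) = (\<Sum>w\<in>B. b w *\<^sub>R w)"
    obtain U f where U: "U \<in> \<W>" "\<And>w. w \<notin> U \<Longrightarrow> ?old a w = 0"
      "(\<Sum>w\<in>U. ?old a w *\<^sub>R w) = (\<Sum>w\<in>A. a w *\<^sub>R w)" and f: "f \<in> F" "a f = 0"
      using old[OF A, of a] aA by blast
    obtain V g where V: "V \<in> \<W>" "\<And>w. w \<notin> V \<Longrightarrow> ?old b w = 0"
      "(\<Sum>w\<in>V. ?old b w *\<^sub>R w) = (\<Sum>w\<in>B. b w *\<^sub>R w)" and g: "g \<in> F" "b g = 0"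
      using old[OF B, of b] bB by blast
    have "?old a = ?old b"
      by (rule compatibleD[OF comp U(1) V(1) _ _ U(2) V(2)]) (use U(3) V(3) eq a0 b0 \<xi>(1) in auto)
    then have E: "a w + a x * \<xi> w = b w + b x * \<xi> w" if "w \<noteq> x" for w
      using fun_cong[of "?old a" "?old b" w] that by simp
    have "f \<noteq> x" "g \<noteq> x" using f g x(3) by auto
    \<comment> \<open>Since \<open>a f = 0\<close>, equation \<open>E\<close> at \<open>f\<close>
      reads \<open>a x * \<xi> f = b f + b x * \<xi> f\<close>. As \<open>\<xi> f\<close> is
      positive, this compares the coefficients of \<open>x\<close>; the reverse inequality comes
      from \<open>g\<close>.\<close>
    have "b x * \<xi> f \<le> a x * \<xi> f" using E[OF \<open>f \<noteq> x\<close>] f(2) b0[rule_format, of f] by linarith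
    then have "b x \<le> a x" using \<xi>(2)[of f] f(1) by simp
    have "a x * \<xi> g \<le> b x * \<xi> g" using E[OF \<open>g \<noteq> x\<close>] g(2) a0[rule_format, of g] by linarith
    then have "a x \<le> b x" using \<xi>(2)[of g] g(1) by simp
    with \<open>b x \<le> a x\<close> have ab: "a x = b x" by simp
    show "a = b"
    proof
      fix w show "a w = b w" using E[of w] ab by (cases "w = x") auto
    qed
  qed
qed

text \<open>To locate \<open>y\<close> in the subdivision, subtract the largest multiple of
  \<open>x\<close> that keeps all coordinates nonnegative. It is the minimum of the ratios
  \<open>c w / \<xi> w\<close> over \<open>F\<close>, and the coordinate at a minimizer
  \<open>v\<close> becomes 0.\<close>

lemma pos_hull_stellar:
  fixes \<xi> :: "real^'n \<Rightarrow> real"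
  assumes W: "finite W" "F \<subseteq> W" "F \<noteq> {}" "x \<notin> W"
    and x: "x = (\<Sum>w\<in>F. \<xi> w *\<^sub>R w)" "\<And>w. w \<in> F \<Longrightarrow> 0 < \<xi> w"
  shows "(\<Union>v\<in>F. pos_hull (insert x (W - {v}))) = pos_hull W"
proof (intro equalityI subsetI)
  have xW: "x \<in> pos_hull W"
    using x pos_hull_mono[OF W(1,2)] by (intro subsetD[OF pos_hull_mono[OF W(1,2)]] pos_hullI[of F \<xi>]) (auto intro: less_imp_le)
  fix y assume "y \<in> (\<Union>v\<in>F. pos_hull (insert x (W - {v})))"
  then obtain v where v: "v \<in> F" "y \<in> pos_hull (insert x (W - {v}))" by blast
  then obtain c where c: "\<And>w. w \<in> insert x (W - {v}) \<Longrightarrow> 0 \<le> c w" "y = (\<Sum>w\<in>insert x (W - {v}). c w *\<^sub>R w)"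
    by (elim pos_hullE) blast
  have "y = c x *\<^sub>R x + (\<Sum>w\<in>W-{v}. c w *\<^sub>R w)"
    unfolding c(2) using W by (subst sum.insert) auto
  moreover have "(\<Sum>w\<in>W-{v}. c w *\<^sub>R w) \<in> pos_hull W"
    using c(1) by (intro subsetD[OF pos_hull_mono[OF W(1), of "W - {v}"]] pos_hullI[of _ c]) auto
  ultimately show "y \<in> pos_hull W"
    using c(1) xW by (auto intro!: pos_hull_add pos_hull_scale)
next
  have fF: "finite F" using W finite_subset by blast
  fix y assume "y \<in> pos_hull W"
  then obtain c where c: "\<And>w. w \<in> W \<Longrightarrow> 0 \<le> c w" "y = (\<Sum>w\<in>W. c w *\<^sub>R w)"
    by (elim pos_hullE) blast
  obtain v where v: "v \<in> F" "\<And>w. w \<in> F \<Longrightarrow> c v / \<xi> v \<le> c w / \<xi> w"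
    using arg_min_if_finite(1)[OF fF W(3), of "\<lambda>w. c w / \<xi> w"]
      arg_min_least[OF fF W(3), of _ "\<lambda>w. c w / \<xi> w"] by (rule that)
  define t where "t = c v / \<xi> v"
  have t0: "0 \<le> t" unfolding t_def using c(1) v(1) W(2) x(2)[OF v(1)] by (auto intro!: divide_nonneg_pos)
  let ?e = "\<lambda>w. c w - (if w \<in> F then t * \<xi> w else 0)"
  have e0: "0 \<le> ?e w" if "w \<in> W" for w
    using v(2)[of w] x(2)[of w] c(1)[OF that] unfolding t_def[symmetric] by (auto simp: pos_le_divide_eq)
  have ev: "?e v = 0" unfolding t_def using v(1) x(2)[OF v(1)] by simp
  have "t *\<^sub>R x = (\<Sum>w\<in>F. (t * \<xi> w) *\<^sub>R w)" unfolding x(1) by (simp add: scaleR_sum_right)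
  also have "\<dots> = (\<Sum>w\<in>W. (if w \<in> F then t * \<xi> w else 0) *\<^sub>R w)" by (rule comb_extend[OF W(1,2)])
  finally have "y - t *\<^sub>R x = (\<Sum>w\<in>W. ?e w *\<^sub>R w)"
    unfolding c(2) by (simp add: scaleR_diff_left sum_subtractf)
  also have "\<dots> = ?e v *\<^sub>R v + (\<Sum>w\<in>W-{v}. ?e w *\<^sub>R w)"
    using W v(1) by (intro sum.remove) auto
  also have "\<dots> = (\<Sum>w\<in>W-{v}. ?e w *\<^sub>R w)" unfolding ev by simp
  also have "\<dots> \<in> pos_hull (W - {v})" using e0 by (intro pos_hullI[OF _ refl]) auto
  finally have r: "y - t *\<^sub>R x \<in> pos_hull (W - {v})" .
  have fi: "finite (insert x (W - {v}))" using W(1) by simp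
  have "t *\<^sub>R x + (y - t *\<^sub>R x) \<in> pos_hull (insert x (W - {v}))"
    by (intro pos_hull_add pos_hull_scale pos_hull_base[OF fi] t0 subsetD[OF pos_hull_mono[OF fi] r]) auto
  then show "y \<in> (\<Union>v\<in>F. pos_hull (insert x (W - {v})))" using v(1) by auto
qed

lemma Union_pos_hull_stellar:
  fixes \<xi> :: "real^'n \<Rightarrow> real"
  assumes "\<And>W. W \<in> \<W> \<Longrightarrow> finite W" "F \<noteq> {}" "x \<notin> \<Union>\<W>"
    and "x = (\<Sum>w\<in>F. \<xi> w *\<^sub>R w)" "\<And>w. w \<in> F \<Longrightarrow> 0 < \<xi> w"
  shows "\<Union>(pos_hull ` stellar \<W> F x) = \<Union>(pos_hull ` \<W>)"
proof -
  have "\<Union>(pos_hull ` stellar \<W> F x)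
      = \<Union>(pos_hull ` {W\<in>\<W>. \<not> F \<subseteq> W}) \<union> (\<Union>W\<in>{W\<in>\<W>. F \<subseteq> W}. \<Union>v\<in>F. pos_hull (insert x (W - {v})))"
    unfolding stellar_def by auto
  also have "(\<Union>W\<in>{W\<in>\<W>. F \<subseteq> W}. \<Union>v\<in>F. pos_hull (insert x (W - {v}))) = \<Union>(pos_hull ` {W\<in>\<W>. F \<subseteq> W})"
  proof (rule SUP_cong[OF refl])
    fix W assume "W \<in> {W\<in>\<W>. F \<subseteq> W}"
    then show "(\<Union>v\<in>F. pos_hull (insert x (W - {v}))) = pos_hull W"
      using assms by (intro pos_hull_stellar[where \<xi>=\<xi>]) auto
  qed
  also have "\<Union>(pos_hull ` {W\<in>\<W>. \<not> F \<subseteq> W}) \<union> \<Union>(pos_hull ` {W\<in>\<W>. F \<subseteq> W})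
      = \<Union>(pos_hull ` ({W\<in>\<W>. \<not> F \<subseteq> W} \<union> {W\<in>\<W>. F \<subseteq> W}))"
    by (simp only: image_Un Union_Un_distrib)
  also have "{W\<in>\<W>. \<not> F \<subseteq> W} \<union> {W\<in>\<W>. F \<subseteq> W} = \<W>" by blast
  finally show ?thesis .
qed

section \<open>Height bounds and termination\<close>

text \<open>\<open>N\<close> is the height function with value \<open>1\<close> on the extreme generators of the original cone, and
  \<open>m\<close> is the multiplicity of that cone.\<close>
definition admissible :: "(real^'n) set \<Rightarrow> (real^'n \<Rightarrow> real) \<Rightarrow> real \<Rightarrow> (real^'n) set set \<Rightarrow> bool" where
  "admissible C N m \<W> \<longleftrightarrow> finite \<W> \<and> \<Union>(pos_hull ` \<W>) = C \<and> compatible \<W> \<and>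
     (\<forall>W\<in>\<W>. finite W \<and> card W = CARD('n) \<and> (\<forall>w\<in>W. int_vec w \<and> 0 \<le> N w) \<and>
        sum N W \<le> real CARD('n) * (3/2) powr (m - real (lattice_index W)) \<and>
        (\<forall>w\<in>W. N w \<le> real CARD('n) / 2 * (3/2) powr (m - real (lattice_index W) - 1)))"

text \<open>Termination measure. With d the dimension, a cone of index i is replaced by at most d
  cones of smaller index; together they contribute at most d (d+1)^(i-1), which is less than
  (d+1)^i.\<close>

definition weight :: "(real^'n) set set \<Rightarrow> nat" where
  "weight \<W> = (\<Sum>W\<in>\<W>. (CARD('n) + 1) ^ lattice_index W)"

text \<open>If \<open>x\<close> is an interior lattice point of the parallelepiped spanned by \<open>F\<close>, then so is its mirror
  image \<open>\<Sum>F - x\<close>, and one of the two has at most half the height of \<open>\<Sum>F\<close>.\<close>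
lemma obtain_low_lattice_point:
  fixes W :: "(real^'n) set" and N :: "real^'n \<Rightarrow> real"
  assumes W: "finite W" "independent W" "span W = UNIV" "\<And>w. w \<in> W \<Longrightarrow> int_vec w"
    and "lattice_index W \<noteq> 1" and N: "linear N"
  obtains F \<xi> x where "F \<subseteq> W" "F \<noteq> {}" "\<And>w. 0 \<le> \<xi> w" "\<And>w. \<xi> w < 1" "\<And>w. \<xi> w > 0 \<longleftrightarrow> w \<in> F"
    "x = (\<Sum>w\<in>F. \<xi> w *\<^sub>R w)" "int_vec x" "2 * N x \<le> sum N F"
proof -
  obtain z where z: "z \<in> lattice_box W (\<lambda>_. 1)" "z \<noteq> 0"
    using lattice_index_1_iff[OF W] assms(5) zero_in_lattice_box by blast
  then obtain c where c: "int_vec z" "\<And>w. w \<in> W \<Longrightarrow> 0 \<le> c w \<and> c w < 1" "z = (\<Sum>w\<in>W. c w *\<^sub>R w)"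
    unfolding lattice_box_def by auto
  define F where "F = {w\<in>W. c w > 0}"
  have F: "F \<subseteq> W" unfolding F_def by blast
  have "finite F" using F W(1) finite_subset by blast
  have z_F: "z = (\<Sum>w\<in>F. c w *\<^sub>R w)"
    unfolding c(3) F_def using W(1) c(2) by (intro sum.mono_neutral_right) (auto simp: less_le)
  then have "F \<noteq> {}" using z(2) by auto
  define z' where "z' = \<Sum>F - z"
  \<comment> \<open>On \<open>F\<close> both \<open>c w\<close> and \<open>1 - c w\<close> lie
    strictly between 0 and 1, so the mirror image has the same support.\<close>
  have z': "z' = (\<Sum>w\<in>F. (1 - c w) *\<^sub>R w)"
    unfolding z'_def z_F by (simp add: scaleR_diff_left sum_subtractf)
  have "int_vec z'" unfolding z'_def using c(1) F W(4) by (intro int_vec_diff int_vec_sum) auto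
  have "N z + N z' = sum N F"
    unfolding z'_def using N by (simp add: linear_diff linear_sum)
  then consider "2 * N z \<le> sum N F" | "2 * N z' \<le> sum N F" by linarith
  then show ?thesis
  proof cases
    case 1
    show ?thesis
      by (rule that[of F "\<lambda>w. if w \<in> F then c w else 0" z])
        (use F \<open>F \<noteq> {}\<close> c 1 z_F in \<open>auto simp: F_def\<close>)
  next
    case 2
    show ?thesis
      by (rule that[of F "\<lambda>w. if w \<in> F then 1 - c w else 0" z'])
        (use F \<open>F \<noteq> {}\<close> c 2 z' \<open>int_vec z'\<close> in \<open>auto simp: F_def less_imp_le\<close>)
  qed
qed

text \<open>The subdivision changes every cone over a set containing \<open>F\<close>, not only that
  of \<open>W0\<close>. Heights of generators are nonnegative, so the height of \<open>F\<close> is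
  at most the height sum of each such set, and the same low point \<open>x\<close> serves all of
  them.\<close>

lemma admissible_refine:
  fixes \<W> :: "(real^'n) set set"
  assumes adm: "admissible C N m \<W>" and N: "linear N"
    and W0: "W0 \<in> \<W>" "lattice_index W0 \<noteq> 1"
  shows "\<exists>\<W>'. admissible C N m \<W>' \<and> weight \<W>' < weight \<W>"
proof -
  let ?d = "real CARD('n)"
  have fin: "finite \<W>" and C: "\<Union>(pos_hull ` \<W>) = C" and comp: "compatible \<W>"
    using adm unfolding admissible_def by auto
  have W: "finite W" "card W = CARD('n)" "\<And>w. w \<in> W \<Longrightarrow> int_vec w" "\<And>w. w \<in> W \<Longrightarrow> 0 \<le> N w"
    "sum N W \<le> ?d * (3/2) powr (m - real (lattice_index W))"
    "\<And>w. w \<in> W \<Longrightarrow> N w \<le> ?d / 2 * (3/2) powr (m - real (lattice_index W) - 1)"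
    if "W \<in> \<W>" for W
    using adm that unfolding admissible_def by auto
  have ind: "independent W" if "W \<in> \<W>" for W
    using compatible_independent[OF comp that W(1)[OF that]] .
  have sp: "span W = UNIV" if "W \<in> \<W>" for W
    using span_eq_UNIV ind W(2) that by blast
  obtain F \<xi> x where F: "F \<subseteq> W0" "F \<noteq> {}" and \<xi>: "\<And>w. 0 \<le> \<xi> w" "\<And>w. \<xi> w < 1" "\<And>w. \<xi> w > 0 \<longleftrightarrow> w \<in> F"
    and x: "x = (\<Sum>w\<in>F. \<xi> w *\<^sub>R w)" "int_vec x" "2 * N x \<le> sum N F"
    by (rule obtain_low_lattice_point[OF W(1)[OF W0(1)] ind[OF W0(1)] sp[OF W0(1)] W(3)[OF W0(1)] W0(2) N], assumption, rule that)
  have \<xi>0: "\<xi> w = 0" if "w \<notin> F" for w using \<xi>(1)[of w] \<xi>(3)[of w] that by auto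
  have fF: "finite F" using F(1) W(1)[OF W0(1)] finite_subset by blast
  have x_sum: "x = (\<Sum>w\<in>W. \<xi> w *\<^sub>R w)" if "W \<in> \<W>" "F \<subseteq> W" for W
    unfolding x(1) using W(1)[OF that(1)] that(2) \<xi>0 by (intro sum.mono_neutral_left) auto
  \<comment> \<open>If \<open>x\<close> were already a generator, it would have coefficient 1 at
    itself by compatibility, but all values of \<xi> are below 1.\<close>
  have xU: "x \<notin> \<Union>\<W>"
  proof
    assume "x \<in> \<Union>\<W>"
    then obtain W where xW: "W \<in> \<W>" "x \<in> W" by blast
    have "(\<lambda>w. if w = x then 1 else 0) = \<xi>"
    proof (rule compatibleD[OF comp xW(1) W0(1)])
      show "(\<Sum>w\<in>W. (if w = x then 1 else 0) *\<^sub>R w) = (\<Sum>w\<in>W0. \<xi> w *\<^sub>R w)"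
        using comb_single[OF W(1)[OF xW(1)] xW(2)] x_sum[OF W0(1) F(1)] by simp
    qed (use xW \<xi>(1) \<xi>0 F(1) in auto)
    from fun_cong[OF this, of x] show False using \<xi>(2)[of x] by simp
  qed
  have xF: "x \<notin> F" using xU F(1) W0(1) by blast
  let ?g = "\<lambda>W. (CARD('n) + 1) ^ lattice_index W"
  let ?P = "{W\<in>\<W>. F \<subseteq> W}" and ?K = "{W\<in>\<W>. \<not> F \<subseteq> W}"
  let ?r = "\<lambda>W v. insert x (W - {v})"
  have lt: "lattice_index (?r W v) < lattice_index W" if "W \<in> ?P" "v \<in> F" for W v
    using that x(2) \<xi>
    by (intro lattice_index_replace[OF W(1) ind sp W(3) _ x_sum]) auto
  have "admissible C N m (stellar \<W> F x)"
    unfolding admissible_def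
  proof (intro conjI ballI)
    show "finite (stellar \<W> F x)" unfolding stellar_def using fin fF by auto
    show "\<Union>(pos_hull ` stellar \<W> F x) = C"
      using Union_pos_hull_stellar[OF W(1) F(2) xU x(1)] \<xi>(3) C by simp
    show "compatible (stellar \<W> F x)"
      by (rule compatible_stellar[OF comp W(1) \<xi>(1,3) x(1) xU xF])
    fix A assume A: "A \<in> stellar \<W> F x"
    have "finite A \<and> card A = CARD('n) \<and> (\<forall>w\<in>A. int_vec w \<and> 0 \<le> N w) \<and>
        sum N A \<le> ?d * (3/2) powr (m - real (lattice_index A)) \<and>
        (\<forall>w\<in>A. N w \<le> ?d / 2 * (3/2) powr (m - real (lattice_index A) - 1))"
      using A
    proof (cases rule: stellar_cases)
      case 1
      then show ?thesis using W by blast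
    next
      case (2 U v)
      let ?e = "m - real (lattice_index U)" and ?e' = "m - real (lattice_index A)"
      have U: "U \<in> \<W>" "F \<subseteq> U" "v \<in> U" using 2 by auto
      have xU': "x \<notin> U" using xU U by blast
      have "lattice_index A < lattice_index U" using lt 2 by simp
      \<comment> \<open>The index drops by at least 1. This pays for the factor 3/2 in the height
        sum; larger drops only weaken the bound.\<close>
      then have e: "?e + 1 \<le> ?e'" by linarith
      have Nx0: "0 \<le> N x"
        unfolding x(1) linear_sum[OF N] using \<xi>(1) U W(4)[OF U(1)]
        by (intro sum_nonneg) (auto simp: linear_cmul[OF N])
      have "sum N F \<le> sum N U" using W(1,4)[OF U(1)] U(2) by (intro sum_mono2) auto
      then have Nx: "2 * N x \<le> sum N U" using x(3) by linarith
      have "sum N A = N x + (sum N U - N v)"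
        unfolding 2(4) using xU' W(1)[OF U(1)] U(3) by (subst sum.insert) (auto simp: sum_diff1)
      then have "sum N A \<le> 3/2 * sum N U" using Nx W(4)[OF U(1,3)] by simp
      also have "\<dots> \<le> 3/2 * (?d * (3/2) powr ?e)" using W(5)[OF U(1)] by simp
      also have "\<dots> = ?d * (3/2) powr (?e + 1)" unfolding powr_add by simp
      also have "\<dots> \<le> ?d * (3/2) powr ?e'" using e by (intro mult_left_mono powr_mono) auto
      finally have sumA: "sum N A \<le> ?d * (3/2) powr ?e'" .
      \<comment> \<open>Half of the old height sum bounds the new height, and the old exponent is at
        most the new one minus 1. This is the source of the \<open>- 1\<close> in the bound for
        single heights.\<close>
      have "N x \<le> ?d / 2 * (3/2) powr ?e" using Nx W(5)[OF U(1)] by simp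
      also have "\<dots> \<le> ?d / 2 * (3/2) powr (?e' - 1)" using e by (intro mult_left_mono powr_mono) auto
      finally have NxA: "N x \<le> ?d / 2 * (3/2) powr (?e' - 1)" .
      have NwA: "N w \<le> ?d / 2 * (3/2) powr (?e' - 1)" if "w \<in> U" for w
      proof -
        have "N w \<le> ?d / 2 * (3/2) powr (?e - 1)" using W(6)[OF U(1) that] .
        also have "\<dots> \<le> ?d / 2 * (3/2) powr (?e' - 1)" using e by (intro mult_left_mono powr_mono) auto
        finally show ?thesis .
      qed
      have "card A = CARD('n)"
        unfolding 2(4) using W(1,2)[OF U(1)] U(3) xU' card_Suc_Diff1[of U v] by simp
      then show ?thesis
        using W(1,3,4)[OF U(1)] x(2) Nx0 sumA NxA NwA 2(4) by auto
    qed
    then show "finite A" "card A = CARD('n)" "sum N A \<le> ?d * (3/2) powr (m - real (lattice_index A))"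
      "\<And>w. w \<in> A \<Longrightarrow> int_vec w" "\<And>w. w \<in> A \<Longrightarrow> 0 \<le> N w"
      "\<And>w. w \<in> A \<Longrightarrow> N w \<le> ?d / 2 * (3/2) powr (m - real (lattice_index A) - 1)" by auto
  qed
  moreover have "weight (stellar \<W> F x) < weight \<W>"
  proof -
    let ?S = "(\<lambda>(W, v). ?r W v) ` (?P \<times> F)"
    have finP: "finite ?P" "finite ?K" using fin by auto
    \<comment> \<open>Kept and new sets may overlap, and different pairs may yield the same new set.
      Either effect can only lower the weight, so inequalities suffice.\<close>
    have "weight (stellar \<W> F x) \<le> sum ?g ?K + sum ?g ?S"
      unfolding weight_def stellar_def using sum.union_inter[of ?K ?S ?g] finP fF by simp
    also have "sum ?g ?S \<le> sum (?g \<circ> (\<lambda>(W, v). ?r W v)) (?P \<times> F)"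
      using finP fF by (intro sum_image_le) auto
    also have "\<dots> = (\<Sum>W\<in>?P. \<Sum>v\<in>F. ?g (?r W v))"
      unfolding sum.cartesian_product by (intro sum.cong) auto
    also have "\<dots> < sum ?g ?P"
    proof (rule sum_strict_mono[OF finP(1)])
      show "?P \<noteq> {}" using W0(1) F(1) by blast
      fix U assume U: "U \<in> ?P"
      obtain v where "v \<in> F" using F(2) by blast
      \<comment> \<open>The index of \<open>U\<close> exceeds another natural number, so it is
        positive and has a predecessor.\<close>
      then obtain k where k: "lattice_index U = Suc k" using lt[OF U] by (metis less_nat_zero_code not0_implies_Suc)
      have "(\<Sum>v\<in>F. ?g (?r U v)) \<le> (\<Sum>v\<in>F. (CARD('n) + 1) ^ k)"
        using lt[OF U] unfolding k less_Suc_eq_le by (intro sum_mono power_increasing) auto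
      also have "\<dots> = card F * (CARD('n) + 1) ^ k" by simp
      also have "\<dots> \<le> CARD('n) * (CARD('n) + 1) ^ k"
        using card_mono[of W0 F] W(1,2)[OF W0(1)] F(1) by (intro mult_right_mono) auto
      also have "\<dots> < ?g U" unfolding k by simp
      finally show "(\<Sum>v\<in>F. ?g (?r U v)) < ?g U" .
    qed
    also have "sum ?g ?K + sum ?g ?P = weight \<W>"
      unfolding weight_def using finP by (subst sum.union_disjoint[symmetric]) (auto intro!: sum.cong)
    finally show ?thesis by simp
  qed
  ultimately show ?thesis by blast
qed

lemma admissible_unimodular:
  assumes "admissible C N m \<W>" "linear N"
  obtains \<W>' where "admissible C N m \<W>'" "\<And>W. W \<in> \<W>' \<Longrightarrow> lattice_index W = 1"
  using assms(1)
proof (induction "weight \<W>" arbitrary: \<W> thesis rule: less_induct)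
  case less
  show ?case
  proof (cases "\<forall>W\<in>\<W>. lattice_index W = 1")
    case True
    then show ?thesis using less.prems by blast
  next
    case False
    then show ?thesis using admissible_refine[OF less.prems(2) assms(2)] less.hyps less.prems(1) by blast
  qed
qed

section \<open>Assembling the triangulation\<close>

theorem theorem4p1:
  fixes V :: "(real^'n) set"
  assumes "CARD('n) \<ge> 3"
    and "finite V" and "card V = CARD('n)" and "independent V" and "\<forall>v\<in>V. rat_vec v"
  shows "\<exists>T. unimodular_triangulation (pos_hull V) T \<and>
           (\<forall>D\<in>T. hilb D \<subseteq>
              (\<lambda>x. (real CARD('n) / 2 * (3/2) powr (real (mu (Delta (pos_hull V))) - 2)) *\<^sub>R x)
                ` Delta (pos_hull V))"
proof -
  obtain U where U: "finite U" "independent U" "card U = CARD('n)" and prim: "\<And>u. u \<in> U \<Longrightarrow> primitive u"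
    and VU: "pos_hull V = pos_hull U"
    using primitive_generators[OF assms(2,4,5)] assms(3) by metis
  define m where "m = real (lattice_index U)"
  let ?K = "real CARD('n) / 2 * (3/2) powr (m - 2)"
  have K: "?K > 0" by simp
  have mu: "real (mu (Delta (pos_hull V))) = m"
    by (simp add: VU m_def mu_Delta_pos_hull[OF U(1,2) prim])
  have Delta: "Delta (pos_hull V) = convex hull (insert 0 U)"
    by (simp add: VU Delta_def extreme_gens_pos_hull[OF U(1,2) prim])
  obtain N :: "real^'n \<Rightarrow> real" where N: "linear N" "\<And>u. u \<in> U \<Longrightarrow> N u = 1"
    using linear_independent_extend[OF U(2), of "\<lambda>_. 1"] by blast
  have "admissible (pos_hull U) N m {U}"
  proof -
    \<comment> \<open>The initial index is \<open>m\<close>, so the height bound for the generators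
      of \<open>U\<close> has exponent -1 and reads 1 \<le> d/3. The bound on the height sum holds
      with equality.\<close>
    have "(1::real) \<le> real CARD('n) / 2 * (3/2) powr (-1)" using assms(1) by (simp add: powr_minus)
    then show ?thesis
      unfolding admissible_def m_def using U N(2) prim compatible_singleton[OF U(1,2)]
      by (simp add: primitive_def)
  qed
  then obtain \<W> where \<W>: "admissible (pos_hull U) N m \<W>" "\<And>W. W \<in> \<W> \<Longrightarrow> lattice_index W = 1"
    using admissible_unimodular N(1) by blast
  have comp: "compatible \<W>" using \<W>(1) unfolding admissible_def by blast
  \<comment> \<open>All indices are now 1, which turns the exponent \<open>m - 1 - 1\<close> of the
    invariant into \<open>m - 2\<close>.\<close>
  have W: "finite W" "card W = CARD('n)" "\<And>w. w \<in> W \<Longrightarrow> int_vec w" "\<And>w. w \<in> W \<Longrightarrow> N w \<le> ?K"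
    if "W \<in> \<W>" for W
    using \<W>(1) \<W>(2)[OF that] that unfolding admissible_def by auto
  have ind: "independent W" if "W \<in> \<W>" for W
    using compatible_independent[OF comp that W(1)[OF that]] .
  have gen: "lattice_gen W = {x. int_vec x}" if "W \<in> \<W>" for W
    by (rule lattice_gen_unimodular[OF W(1)[OF that] ind[OF that] span_eq_UNIV[OF ind[OF that] W(2)[OF that]]
          W(3)[OF that] \<W>(2)[OF that]])
  have "unimodular_cone (pos_hull W)" if "W \<in> \<W>" for W
  proof -
    note fW = W(1)[OF that] and iW = ind[OF that]
    have "rat_vec w" if "w \<in> W" for w
      using W(3)[OF \<open>W \<in> \<W>\<close> that] Ints_subset_Rats unfolding int_vec_def rat_vec_def by blast
    then have "simplicial_cone (pos_hull W)"
      unfolding simplicial_cone_def using fW iW by blast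
    then show ?thesis
      using mu_Delta_pos_hull[OF fW iW primitive_unimodular[OF fW iW gen[OF that]]] \<W>(2)[OF that]
      by (simp add: unimodular_cone_def)
  qed
  moreover have "finite \<W>" "\<Union>(pos_hull ` \<W>) = pos_hull V"
    using \<W>(1) VU unfolding admissible_def by auto
  moreover have "(pos_hull A \<inter> pos_hull B) face_of pos_hull A \<and> (pos_hull A \<inter> pos_hull B) face_of pos_hull B"
    if "A \<in> \<W>" "B \<in> \<W>" for A B
    unfolding compatible_Int[OF comp that W(1)[OF that(1)] W(1)[OF that(2)]]
    using that W(1) ind by (auto intro!: pos_hull_face)
  ultimately have "unimodular_triangulation (pos_hull V) (pos_hull ` \<W>)"
    unfolding unimodular_triangulation_def by auto
  moreover have "hilb (pos_hull W) \<subseteq> (\<lambda>x. ?K *\<^sub>R x) ` Delta (pos_hull V)" if "W \<in> \<W>" for W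
  proof
    fix w assume "w \<in> hilb (pos_hull W)"
    then have w: "w \<in> W" using hilb_unimodular[OF W(1) ind gen] that by simp
    then have "w \<in> pos_hull U"
      using \<W>(1) that pos_hull_base[OF W(1)[OF that]] unfolding admissible_def by blast
    then obtain c where c: "\<And>u. u \<in> U \<Longrightarrow> 0 \<le> c u" "w = (\<Sum>u\<in>U. c u *\<^sub>R u)"
      by (elim pos_hullE) blast
    \<comment> \<open>The height is the sum of the coordinates over \<open>U\<close>. A bound on it
      says that \<open>w\<close> divided by the dilation factor is a combination with total weight
      at most 1, hence a point of the simplex with vertex 0.\<close>
    have "N w = sum c U" unfolding c(2) linear_sum[OF N(1)] by (simp add: linear_cmul[OF N(1)] N(2))
    then have "(\<Sum>u\<in>U. c u / ?K) \<le> 1"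
      unfolding sum_divide_distrib[symmetric] using W(4)[OF that w] K by simp
    then have "(\<Sum>u\<in>U. (c u / ?K) *\<^sub>R u) \<in> convex hull (insert 0 U)"
      using c(1) by (intro convex_comb_0 U(1)) auto
    moreover have "w = ?K *\<^sub>R (\<Sum>u\<in>U. (c u / ?K) *\<^sub>R u)"
      unfolding c(2) scaleR_sum_right using K by (intro sum.cong) auto
    ultimately show "w \<in> (\<lambda>x. ?K *\<^sub>R x) ` Delta (pos_hull V)" unfolding Delta by (rule rev_image_eqI)
  qed
  ultimately show ?thesis unfolding mu by blast
qed

end
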